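(* Let $(X,Y,Z)=\{(X(t),Y(t),Z(t))\}_{t\ge0}$ be an orthogonal random motion in $\mathbb{R}^3$ with speed $c>0$ and rate function $\lambda\in C^2((0,\infty),(0,\infty))$, and let $(T_x,T_y,T_z)=\{(T_x(t),T_y(t),T_z(t))\}_{t\ge0}$ be the process describing the times spent by $(X,Y,Z)$ during $[0,t]$ moving parallel to the $x$-, $y$- and $z$-axis, respectively. For $t>0$ and $s,r>0$ with $s+r<t$, let $p(t,s,r)$ be the density defined by $$p(t,s,r)\,ds\,dr=P\{T_x(t)\in ds,\ T_y(t)\in dr,\ T_x(t)+T_y(t)+T_z(t)=t\}.$$ Then $$p(t,s,r)=\frac{3\sqrt3\,c^2}{2}\,q\Bigl(t,\ \frac c2(3s-t),\ \frac{\sqrt3\,c}{2}(s+2r-t)\Bigr),$$ where (i) if $(X,Y,Z)$ is an orthogonal standard motion (OSM), $q$ is the transition density of a symmetrically deviating planar random motion with directions $v_0,v_1,v_2$ and rate function $\lambda$; (ii) if $(X,Y,Z)$ is an orthogonal uniform motion (OUM), $q$ is the transition density of a uniform planar random motion with directions $v_0,v_1,v_2$ and rate function $\lambda$. Here $v_0=(c,0)$, $v_1=(-c/2,\sqrt3c/2)$, $v_2=(-c/2,-\sqrt3c/2)$.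
   Context: Motions in $\mathbb{R}^3$. Let $d_0=(1,0,0)$, $d_1=(0,1,0)$, $d_2=(0,0,1)$, $d_3=(-1,0,0)$, $d_4=(0,-1,0)$, $d_5=(0,0,-1)$. An orthogonal random motion with speed $c>0$ and rate function $\lambda:(0,\infty)\to(0,\infty)$ is the process $(X(t),Y(t),Z(t))=c\int_0^t D(s)\,ds$, where $D(s)\in\{d_0,\dots,d_5\}$ is the current direction. The initial direction $D(0)$ is uniform on the six directions, and $D$ can change only at the events of a (possibly non-homogeneous) Poisson process with rate function $\lambda$, independent of the choices of direction. At each event the new direction is chosen, given the current one and independently of the rest of the past, as follows. - Orthogonal standard motion (OSM): uniformly among the four directions orthogonal to the current one. - Orthogonal uniform motion (OUM): uniformly among all six directions (including the current one and its opposite). $T_x(t),T_y(t),T_z(t)$ are the Lebesgue measures of the sets of times $u\in[0,t]$ with $D(u)\in\{d_0,d_3\}$, $D(u)\in\{d_1,d_4\}$, $D(u)\in\{d_2,d_5\}$, respectively; hence $T_x(t)+T_y(t)+T_z(t)=t$ almost surely. Planar motions with three directions. A planar random motion with directions $v_0=(c,0)$, $v_1=(-c/2,\sqrt3c/2)$, $v_2=(-c/2,-\sqrt3c/2)$ and rate function $\mu$ starts at the origin of $\mathbb{R}^2$ with velocity uniform on $\{v_0,v_1,v_2\}$. It moves with constant velocity between the events of a Poisson process with rate function $\mu$, and at each event chooses a new velocity. It is called uniform if the new velocity is chosen uniformly among all three (including the current one), and symmetrically deviating if it is chosen uniformly between the two velocities different from the current one. At time $t$ its position lies in the closed triangle with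 vertices $tv_0,tv_1,tv_2$. Its transition density $q(t,u,v)$ is the density of the (absolutely continuous part of the) law of its position at time $t$ in the interior of this triangle. The integral $\Lambda(t)=\int_0^t\lambda(s)\,ds$ may be infinite. In that case events accumulate at time $0$, and the direction (respectively velocity) process on $(0,\infty)$ is understood as the time-inhomogeneous Markov jump process for which events occur at rate $\lambda(t)$ at time $t$, the new direction (respectively velocity) at each event being chosen uniformly among the four directions orthogonal to the current one (OSM), uniformly among all six directions (OUM), uniformly among all three velocities $v_0,v_1,v_2$ (uniform planar motion), or uniformly between the two velocities different from the current one (symmetrically deviating planar motion), and whose law at every time $t>0$ is uniform on the set of possible directions (respectively velocities) (a property that also holds when $\Lambda(t)<\infty$). *)

theory Defs
  imports "HOL-Probability.Probability"
begin

section \<open>Poisson events\<close>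

text \<open>
  Rate functions live on the open half-line, and \<open>\<integral>\<^sub>0\<^sup>t lam\<close> may be infinite; then events accumulate
  at time \<open>0\<close>. A time is admissible if the events can be enumerated in increasing order from it
  onwards: every positive time is, and time \<open>0\<close> is admissible iff the cumulative rate is finite.
\<close>

definition admissible_times :: "(real \<Rightarrow> real) \<Rightarrow> real set" where
  "admissible_times lam =
     {s. 0 < s \<or> s = 0 \<and> (\<forall>t>0. set_integrable lborel {0<..t} lam)}"

definition cumulative_rate :: "(real \<Rightarrow> real) \<Rightarrow> real \<Rightarrow> real \<Rightarrow> real" where
  "cumulative_rate lam a b = set_lebesgue_integral lborel {a<..b} lam"

definition num_events :: "('w \<Rightarrow> real set) \<Rightarrow> real \<Rightarrow> real \<Rightarrow> 'w \<Rightarrow> nat" where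
  "num_events E a b w = card (E w \<inter> {a<..b})"

text \<open>\<open>E w\<close> is the random set of event times.\<close>

definition poisson_events :: "'w measure \<Rightarrow> (real \<Rightarrow> real) \<Rightarrow> ('w \<Rightarrow> real set) \<Rightarrow> bool" where
  "poisson_events M lam E \<longleftrightarrow>
     (\<forall>w\<in>space M. E w \<subseteq> {0<..} \<and>
        (\<forall>a\<in>admissible_times lam. \<forall>b. finite (E w \<inter> {a<..b}))) \<and>
     (\<forall>a\<in>admissible_times lam. \<forall>b>a. \<forall>k.
        measure M {w\<in>space M. num_events E a b w = k}
          = pmf (poisson_pmf (cumulative_rate lam a b)) k) \<and>
     (\<forall>(t :: nat \<Rightarrow> real) n. t 0 \<in> admissible_times lam \<and> (\<forall>i<n. t i < t (Suc i)) \<longrightarrow>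
        prob_space.indep_vars M (\<lambda>_. count_space UNIV)
          (\<lambda>i. num_events E (t i) (t (Suc i))) {..<n})"

text \<open>
  \<open>event_time A s n\<close> is the \<open>n\<close>-th point of \<open>A\<close> after time \<open>s\<close>, and \<open>s\<close> itself for \<open>n = 0\<close>. It is
  only meaningful if \<open>A\<close> has at least \<open>n\<close> points after \<open>s\<close>.
\<close>

primrec event_time :: "real set \<Rightarrow> real \<Rightarrow> nat \<Rightarrow> real" where
  "event_time A s 0 = s"
| "event_time A s (Suc n) = Inf (A \<inter> {event_time A s n<..})"

text \<open>The \<open>\<sigma>\<close>-algebra generated by the Poisson process after time \<open>s\<close>.\<close>

definition events_after :: "'w measure \<Rightarrow> ('w \<Rightarrow> real set) \<Rightarrow> real \<Rightarrow> 'w set set" where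
  "events_after M E s =
     sigma_sets (space M)
       {{w\<in>space M. num_events E a b w = k} | a b k. s \<le> a \<and> a \<le> b}"

section \<open>Processes switching at Poisson events\<close>

text \<open>
  \<open>switching_process M lam S ch D\<close>: the process \<open>D\<close> takes values in the finite set \<open>S\<close>, is uniform
  on \<open>S\<close> at every admissible time, and changes only at the events of a Poisson process with rate
  function \<open>lam\<close>; at an event, the new value is uniform on \<open>ch d\<close>, where \<open>d\<close> is the current value,
  independently of the past and of the Poisson process.

  The last clause states this for the successive values \<open>D(s), D(e\<^sub>1), \<dots>, D(e\<^sub>n)\<close>, where
  \<open>e\<^sub>1 < e\<^sub>2 < \<dots>\<close> are the events after \<open>s\<close>. As the total number of events may be finite, \<open>A\<close> ranges
  over those events of the Poisson \<open>\<sigma>\<close>-algebra on which \<open>e\<^sub>n\<close> exists. If \<open>0\<close> is admissible, \<open>s = 0\<close>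
  gives the construction from the uniform value \<open>D(0)\<close>. Otherwise, letting \<open>s\<close> range over all
  positive times describes the Markov jump process on the open half-line with uniform one-dimensional
  marginals, and \<open>D(0)\<close> is irrelevant.
\<close>

definition switching_process ::
  "'w measure \<Rightarrow> (real \<Rightarrow> real) \<Rightarrow> 'd set \<Rightarrow> ('d \<Rightarrow> 'd set) \<Rightarrow> (real \<Rightarrow> 'w \<Rightarrow> 'd) \<Rightarrow> bool" where
  "switching_process M lam S ch D \<longleftrightarrow> prob_space M \<and> (\<exists>E.
     poisson_events M lam E \<and>
     (\<forall>t\<in>admissible_times lam. D t \<in> measurable M (count_space S)) \<and>
     (\<forall>w\<in>space M. \<forall>a\<in>admissible_times lam. \<forall>b\<ge>a.
        E w \<inter> {a<..b} = {} \<longrightarrow> D b w = D a w) \<and>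
     (\<forall>s\<in>admissible_times lam. \<forall>n. \<forall>d :: nat \<Rightarrow> 'd. \<forall>A\<in>events_after M E s.
        (\<forall>w\<in>A. \<exists>b. n \<le> num_events E s b w) \<longrightarrow>
        measure M (A \<inter> {w\<in>space M. \<forall>i\<le>n. D (event_time (E w) s i) w = d i})
          = measure M A * pmf (pmf_of_set S) (d 0)
              * (\<Prod>i<n. pmf (pmf_of_set (ch (d i))) (d (Suc i)))))"

section \<open>Orthogonal motions in space\<close>

definition dir_x :: "(real \<times> real \<times> real) set" where
  "dir_x = {(1, 0, 0), (-1, 0, 0)}"

definition dir_y :: "(real \<times> real \<times> real) set" where
  "dir_y = {(0, 1, 0), (0, -1, 0)}"

definition dir_z :: "(real \<times> real \<times> real) set" where
  "dir_z = {(0, 0, 1), (0, 0, -1)}"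

definition dirs :: "(real \<times> real \<times> real) set" where
  "dirs = dir_x \<union> dir_y \<union> dir_z"

definition orthogonal_standard_motion ::
  "'w measure \<Rightarrow> real \<Rightarrow> (real \<Rightarrow> real) \<Rightarrow> (real \<Rightarrow> 'w \<Rightarrow> real \<times> real \<times> real)
    \<Rightarrow> (real \<Rightarrow> 'w \<Rightarrow> real \<times> real \<times> real) \<Rightarrow> bool" where
  "orthogonal_standard_motion M c lam D R \<longleftrightarrow>
     switching_process M lam dirs (\<lambda>d. {e\<in>dirs. e \<bullet> d = 0}) D \<and>
     (\<forall>t\<ge>0. \<forall>w\<in>space M. R t w = c *\<^sub>R integral {0..t} (\<lambda>u. D u w))"

definition orthogonal_uniform_motion ::
  "'w measure \<Rightarrow> real \<Rightarrow> (real \<Rightarrow> real) \<Rightarrow> (real \<Rightarrow> 'w \<Rightarrow> real \<times> real \<times> real)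
    \<Rightarrow> (real \<Rightarrow> 'w \<Rightarrow> real \<times> real \<times> real) \<Rightarrow> bool" where
  "orthogonal_uniform_motion M c lam D R \<longleftrightarrow>
     switching_process M lam dirs (\<lambda>d. dirs) D \<and>
     (\<forall>t\<ge>0. \<forall>w\<in>space M. R t w = c *\<^sub>R integral {0..t} (\<lambda>u. D u w))"

definition occupation_time :: "'d set \<Rightarrow> (real \<Rightarrow> 'w \<Rightarrow> 'd) \<Rightarrow> real \<Rightarrow> 'w \<Rightarrow> real" where
  "occupation_time A D t w = measure lborel {u\<in>{0..t}. D u w \<in> A}"

section \<open>Planar motions with three directions\<close>

definition vel0 :: "real \<Rightarrow> real \<times> real" where
  "vel0 c = (c, 0)"

definition vel1 :: "real \<Rightarrow> real \<times> real" where
  "vel1 c = (- c / 2, sqrt 3 * c / 2)"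

definition vel2 :: "real \<Rightarrow> real \<times> real" where
  "vel2 c = (- c / 2, - (sqrt 3 * c / 2))"

definition vels :: "real \<Rightarrow> (real \<times> real) set" where
  "vels c = {vel0 c, vel1 c, vel2 c}"

definition planar_uniform_motion ::
  "'w measure \<Rightarrow> real \<Rightarrow> (real \<Rightarrow> real) \<Rightarrow> (real \<Rightarrow> 'w \<Rightarrow> real \<times> real)
    \<Rightarrow> (real \<Rightarrow> 'w \<Rightarrow> real \<times> real) \<Rightarrow> bool" where
  "planar_uniform_motion M c mu V R \<longleftrightarrow>
     switching_process M mu (vels c) (\<lambda>v. vels c) V \<and>
     (\<forall>t\<ge>0. \<forall>w\<in>space M. R t w = integral {0..t} (\<lambda>u. V u w))"

definition planar_deviating_motion ::
  "'w measure \<Rightarrow> real \<Rightarrow> (real \<Rightarrow> real) \<Rightarrow> (real \<Rightarrow> 'w \<Rightarrow> real \<times> real)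
    \<Rightarrow> (real \<Rightarrow> 'w \<Rightarrow> real \<times> real) \<Rightarrow> bool" where
  "planar_deviating_motion M c mu V R \<longleftrightarrow>
     switching_process M mu (vels c) (\<lambda>v. vels c - {v}) V \<and>
     (\<forall>t\<ge>0. \<forall>w\<in>space M. R t w = integral {0..t} (\<lambda>u. V u w))"

definition open_triangle :: "real \<Rightarrow> real \<Rightarrow> (real \<times> real) set" where
  "open_triangle c t = interior (convex hull {t *\<^sub>R vel0 c, t *\<^sub>R vel1 c, t *\<^sub>R vel2 c})"

section \<open>Densities\<close>

definition density_on ::
  "(('b :: euclidean_space) set \<Rightarrow> ennreal) \<Rightarrow> 'b set \<Rightarrow> ('b \<Rightarrow> real) \<Rightarrow> bool" where
  "density_on \<nu> A f \<longleftrightarrow>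
     f \<in> borel_measurable (restrict_space borel A) \<and> (\<forall>x\<in>A. 0 \<le> f x) \<and>
     (\<forall>B\<in>sets borel. B \<subseteq> A \<longrightarrow> \<nu> B = (\<integral>\<^sup>+x\<in>B. ennreal (f x) \<partial>lborel))"

text \<open>
  Density on \<open>A\<close> of the absolutely continuous part: the null set \<open>N\<close> carries the singular part of
  the Lebesgue decomposition of \<open>\<nu>\<close> on \<open>A\<close>.
\<close>

definition ac_density_on ::
  "(('b :: euclidean_space) set \<Rightarrow> ennreal) \<Rightarrow> 'b set \<Rightarrow> ('b \<Rightarrow> real) \<Rightarrow> bool" where
  "ac_density_on \<nu> A f \<longleftrightarrow> (\<exists>N\<in>null_sets lborel. density_on \<nu> (A - N) f)"

definition transition_density ::
  "'w measure \<Rightarrow> real \<Rightarrow> (real \<Rightarrow> 'w \<Rightarrow> real \<times> real) \<Rightarrow> (real \<Rightarrow> real \<Rightarrow> real \<Rightarrow> real) \<Rightarrow> bool"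
where
  "transition_density M c R q \<longleftrightarrow>
     (\<forall>t>0. ac_density_on (\<lambda>B. emeasure M {w\<in>space M. R t w \<in> B})
              (open_triangle c t) (\<lambda>(u, v). q t u v))"

definition open_simplex :: "real \<Rightarrow> (real \<times> real) set" where
  "open_simplex t = {(s, r). 0 < s \<and> 0 < r \<and> s + r < t}"

definition occupation_density ::
  "'w measure \<Rightarrow> (real \<Rightarrow> 'w \<Rightarrow> real \<times> real \<times> real) \<Rightarrow> (real \<Rightarrow> real \<Rightarrow> real \<Rightarrow> real) \<Rightarrow> bool"
where
  "occupation_density M D p \<longleftrightarrow>
     (\<forall>t>0. density_on
        (\<lambda>B. emeasure M {w\<in>space M.
            (occupation_time dir_x D t w, occupation_time dir_y D t w) \<in> B \<and>
            occupation_time dir_x D t w + occupation_time dir_y D t w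
              + occupation_time dir_z D t w = t})
        (open_simplex t) (\<lambda>(s, r). p t s r))"

end

theory Submission
  imports Defs
begin

text \<open>
  The axis along which the orthogonal motion moves, and the velocity of the planar motion, are chains
  on three states with the same uniform initial law and the same transition matrix (uniform on all
  three states for OUM, on the two other states for OSM), both switched by Poisson events of rate
  \<open>lam\<close>. Conditioning on the event counts between finitely many positive times shows that the two
  three-state processes have the same finite-dimensional distributions. As their paths are right
  continuous with finitely many jumps on compact subsets of the open half-line, the occupation times
  are limits of functions of finitely many values, so \<open>(T\<^sub>x, T\<^sub>y)\<close> and the pair of times spent with
  velocities \<open>v\<^sub>0\<close>, \<open>v\<^sub>1\<close> have the same law. The planar position is an affine image of the latter pair
  with Jacobian \<open>3 * sqrt 3 * c\<^sup>2 / 2\<close>.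
\<close>

section \<open>Lumped path weights\<close>

text \<open>The two motions live on unrelated probability spaces, so they can only be compared
  through their laws; the link is a formula that mentions nothing but \<open>lam\<close>, the
  initial law of the labels and their transition kernel. The axis is itself a chain by strong
  lumpability: each axis carries two directions, and the mass that the kernel gives to a target axis
  depends only on the current axis. Three obstacles shape the argument. If \<open>lam\<close> is not
  integrable at 0, events cannot be enumerated from 0 onwards, so all observation times are strictly
  positive and the chain is started there from its uniform law. Values of \<open>D\<close> at fixed
  times are measurable by hypothesis, but values at random event times come only with a number for
  their measure, so they serve merely to cut measurable events into pieces. Finally, densities are
  determined only almost everywhere, and \<open>q\<close> describes the planar law only off a null
  set; the pointwise identity therefore needs continuous versions.\<close>

definition path_weight :: "'d pmf \<Rightarrow> ('d \<Rightarrow> 'd pmf) \<Rightarrow> nat \<Rightarrow> (nat \<Rightarrow> 'd) \<Rightarrow> real" where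
  "path_weight p k n d = pmf p (d 0) * (\<Prod>i<n. pmf (k (d i)) (d (Suc i)))"

lemma sum_pmf_fibre:
  assumes "finite S" "set_pmf p \<subseteq> S"
  shows "(\<Sum>x | x \<in> S \<and> f x = b. pmf p x) = pmf (map_pmf f p) b"
proof -
  have "pmf (map_pmf f p) b = measure p (f -` {b})"
    by (simp add: pmf_map)
  also have "\<dots> = measure p {x\<in>S. f x = b}"
    using assms(2) by (intro measure_pmf.finite_measure_eq_AE) (auto simp: AE_measure_pmf_iff)
  also have "\<dots> = (\<Sum>x | x \<in> S \<and> f x = b. pmf p x)"
    using assms(1) by (subst measure_measure_pmf_finite) auto
  finally show ?thesis by simp
qed

text \<open>Strong lumpability: after peeling off the last step, the successors of
  \<open>d n\<close> with label \<open>a (Suc n)\<close> carry the mass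
  \<open>pmf (k' (a n)) (a (Suc n))\<close>. It is the same for every \<open>d\<close> in the fibre
  and factors out of the sum.\<close>

lemma sum_path_weight_fibre:
  assumes "finite S" "set_pmf p \<subseteq> S" "\<And>d. d \<in> S \<Longrightarrow> set_pmf (k d) \<subseteq> S"
    and "map_pmf f p = p'" "\<And>d. d \<in> S \<Longrightarrow> map_pmf f (k d) = k' (f d)"
  shows "(\<Sum>d \<in> PiE {..n} (\<lambda>i. {x\<in>S. f x = a i}). path_weight p k n d) = path_weight p' k' n a"
proof (induction n)
  case 0
  have "(\<Sum>d \<in> PiE {..0::nat} (\<lambda>i. {x\<in>S. f x = a i}). path_weight p k 0 d)
      = (\<Sum>x | x \<in> S \<and> f x = a 0. pmf p x)"
    by (rule sum.reindex_bij_witness[of _ "\<lambda>x. (\<lambda>i\<in>{..0}. x)" "\<lambda>d. d 0"])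
       (auto simp: path_weight_def PiE_def extensional_def restrict_def fun_eq_iff)
  then show ?case
    using sum_pmf_fibre[OF assms(1,2), of f "a 0"] assms(4) by (simp add: path_weight_def)
next
  case (Suc n)
  let ?F = "\<lambda>i. {x\<in>S. f x = a i}"
  have "(\<Sum>d \<in> PiE {..Suc n} ?F. path_weight p k (Suc n) d)
      = (\<Sum>(y, d) \<in> ?F (Suc n) \<times> PiE {..n} ?F. path_weight p k (Suc n) (d(Suc n := y)))"
    unfolding atMost_Suc PiE_insert_eq
    by (subst sum.reindex[OF inj_combinator]) (auto simp: case_prod_unfold)
  also have "\<dots> = (\<Sum>d \<in> PiE {..n} ?F. \<Sum>y\<in>?F (Suc n). path_weight p k n d * pmf (k (d n)) y)"
    by (subst sum.cartesian_product[symmetric], subst sum.swap, intro sum.cong)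
       (auto simp: path_weight_def)
  also have "\<dots> = (\<Sum>d \<in> PiE {..n} ?F. path_weight p k n d * pmf (k' (a n)) (a (Suc n)))"
  proof (intro sum.cong refl)
    fix d assume "d \<in> PiE {..n} ?F"
    then have d: "d n \<in> S" "f (d n) = a n" by auto
    show "(\<Sum>y\<in>?F (Suc n). path_weight p k n d * pmf (k (d n)) y)
        = path_weight p k n d * pmf (k' (a n)) (a (Suc n))"
      using sum_pmf_fibre[OF assms(1) assms(3)[OF d(1)], of f "a (Suc n)"] assms(5)[OF d(1)] d(2)
      by (simp add: sum_distrib_left[symmetric])
  qed
  also have "\<dots> = path_weight p' k' (Suc n) a"
    using Suc by (simp add: sum_distrib_right[symmetric]) (simp add: path_weight_def)
  finally show ?case .
qed

text \<open>All states are collapsed to a single label; the lumped chain then has one path, of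
  weight 1.\<close>

lemma sum_path_weight:
  assumes "finite S" "set_pmf p \<subseteq> S" "\<And>d. d \<in> S \<Longrightarrow> set_pmf (k d) \<subseteq> S"
  shows "(\<Sum>d \<in> PiE {..n} (\<lambda>_. S). path_weight p k n d) = 1"
  using sum_path_weight_fibre[OF assms, where f = "\<lambda>_. ()" and p' = "return_pmf ()"
      and k' = "\<lambda>_. return_pmf ()" and n = n and a = "\<lambda>_. ()"]
  by (auto simp: map_pmf_const) (simp add: path_weight_def)

text \<open>State paths are grouped by their label path. By its hypothesis \<open>C\<close> looks
  only at indices up to \<open>n\<close>, so the label path may be replaced by its extensional
  restriction to \<open>{..n}\<close>.\<close>

lemma sum_path_weight_lumped:
  assumes "finite S" "set_pmf p \<subseteq> S" "\<And>d. d \<in> S \<Longrightarrow> set_pmf (k d) \<subseteq> S"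
    and "map_pmf f p = p'" "\<And>d. d \<in> S \<Longrightarrow> map_pmf f (k d) = k' (f d)"
    and C: "\<And>d e. (\<And>i. i \<le> n \<Longrightarrow> d i = e i) \<Longrightarrow> C d \<Longrightarrow> C e"
  shows "(\<Sum>d | d \<in> PiE {..n} (\<lambda>_. S) \<and> C (\<lambda>i. f (d i)). path_weight p k n d)
       = (\<Sum>a | a \<in> PiE {..n} (\<lambda>_. f ` S) \<and> C a. path_weight p' k' n a)"
proof -
  let ?Q = "{a \<in> PiE {..n} (\<lambda>_. f ` S). C a}"
  let ?F = "\<lambda>a. PiE {..n} (\<lambda>i. {x\<in>S. f x = a i})"
  have fin: "finite (PiE {..n} (\<lambda>_. f ` S))" "\<And>a. finite (?F a)"
    using assms(1) by (auto intro!: finite_PiE)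
  have "{d \<in> PiE {..n} (\<lambda>_. S). C (\<lambda>i. f (d i))} = (\<Union>a\<in>?Q. ?F a)"
  proof (intro set_eqI iffI)
    fix d assume "d \<in> {d \<in> PiE {..n} (\<lambda>_. S). C (\<lambda>i. f (d i))}"
    then have d: "d \<in> PiE {..n} (\<lambda>_. S)" "C (\<lambda>i. f (d i))" by auto
    let ?a = "\<lambda>i\<in>{..n}. f (d i)"
    have "C ?a" by (rule C[OF _ d(2)]) auto
    then have "?a \<in> ?Q" using d(1) by auto
    moreover have "d \<in> ?F ?a" using d(1) by (auto simp: PiE_def)
    ultimately show "d \<in> (\<Union>a\<in>?Q. ?F a)" by blast
  next
    fix d assume "d \<in> (\<Union>a\<in>?Q. ?F a)"
    then obtain a where a: "a \<in> ?Q" "d \<in> ?F a" by blast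
    have "C (\<lambda>i. f (d i))" by (rule C[of a]) (use a in \<open>auto simp: PiE_def Pi_def\<close>)
    then show "d \<in> {d \<in> PiE {..n} (\<lambda>_. S). C (\<lambda>i. f (d i))}" using a by (auto simp: PiE_def Pi_def)
  qed
  then have "(\<Sum>d | d \<in> PiE {..n} (\<lambda>_. S) \<and> C (\<lambda>i. f (d i)). path_weight p k n d)
      = (\<Sum>d\<in>(\<Union>a\<in>?Q. ?F a). path_weight p k n d)" by simp
  also have "\<dots> = (\<Sum>a\<in>?Q. \<Sum>d\<in>?F a. path_weight p k n d)"
  proof (rule sum.UNION_disjoint)
    show "\<forall>a\<in>?Q. \<forall>b\<in>?Q. a \<noteq> b \<longrightarrow> ?F a \<inter> ?F b = {}"
    proof (intro ballI impI equals0I)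
      fix a b d assume ab: "a \<in> ?Q" "b \<in> ?Q" "a \<noteq> b" "d \<in> ?F a \<inter> ?F b"
      have "a i = b i" if "i \<in> {..n}" for i
        using ab(4) that by (metis (mono_tags, lifting) Int_iff PiE_mem mem_Collect_eq)
      then have "a = b" by (intro PiE_ext[of a "{..n}" _ b]) (use ab in auto)
      then show False using ab by simp
    qed
  qed (use fin in auto)
  also have "\<dots> = (\<Sum>a\<in>?Q. path_weight p' k' n a)"
    using sum_path_weight_fibre[where f = f and k' = k', OF assms(1-5)] by simp
  finally show ?thesis .
qed

text \<open>
  No measurability of the sets \<open>X d\<close> is assumed: a set outside the \<open>\<sigma>\<close>-algebra has measure \<open>0\<close>,
  so both \<open>B\<close> and \<open>A - B\<close> are bounded from below, and the bounds add up to the measure of \<open>A\<close>.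
\<close>

lemma (in finite_measure) measure_disjoint_cover:
  assumes "finite P" "Q \<subseteq> P" "A \<in> sets M" "B \<in> sets M"
    and "disjoint_family_on X P" "A = (\<Union>d\<in>P. X d)" "B = (\<Union>d\<in>Q. X d)"
    and X: "\<And>d. d \<in> P \<Longrightarrow> measure M (X d) = measure M A * v d" and v: "sum v P = 1"
  shows "measure M B = measure M A * sum v Q"
proof -
  have low: "measure M A * sum v R \<le> measure M C"
    if R: "R \<subseteq> P" "C \<in> sets M" "(\<Union>d\<in>R. X d) \<subseteq> C" for R C
  proof -
    let ?R = "{d\<in>R. X d \<in> sets M}"
    have fin: "finite R" using R(1) assms(1) finite_subset by blast
    have "measure M A * sum v R = (\<Sum>d\<in>R. measure M (X d))"
      using R(1) X by (auto simp: sum_distrib_left intro!: sum.cong)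
    also have "\<dots> = (\<Sum>d\<in>?R. measure M (X d))"
      using fin by (intro sum.mono_neutral_right) (auto simp: measure_notin_sets)
    also have "\<dots> = measure M (\<Union>d\<in>?R. X d)"
      using fin assms(5) R(1)
      by (intro finite_measure_finite_Union[symmetric])
         (auto simp: disjoint_family_on_def)
    also have "\<dots> \<le> measure M C"
      using R fin by (intro finite_measure_mono) auto
    finally show ?thesis .
  qed
  have "(\<Union>d\<in>P - Q. X d) \<subseteq> A - B"
    using assms(2,5,6,7) by (fastforce simp: disjoint_family_on_def)
  then have "measure M A * sum v (P - Q) \<le> measure M (A - B)"
    using assms by (intro low) auto
  moreover have "measure M A * sum v Q \<le> measure M B"
    using assms by (intro low) auto
  moreover have "measure M (A - B) = measure M A - measure M B"
    using assms by (intro finite_measure_Diff) auto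
  moreover have "sum v (P - Q) = 1 - sum v Q"
    using assms(1,2) v by (subst sum_diff) auto
  ultimately show ?thesis by (simp add: algebra_simps)
qed

section \<open>Enumerating and counting event points\<close>

lemma event_time_bounds:
  assumes "finite (A \<inter> {s<..b})" "s \<le> b" "n \<le> card (A \<inter> {s<..b})"
  shows "s \<le> event_time A s n \<and> event_time A s n \<le> b
    \<and> card (A \<inter> {event_time A s n<..b}) = card (A \<inter> {s<..b}) - n"
  using assms(3)
proof (induction n)
  case 0
  then show ?case using assms(2) by simp
next
  case (Suc n)
  let ?e = "event_time A s n"
  let ?C = "A \<inter> {?e<..b}"
  have IH: "s \<le> ?e" "?e \<le> b" "card ?C = card (A \<inter> {s<..b}) - n"
    using Suc by auto
  have fin: "finite ?C" by (rule finite_subset[OF _ assms(1)]) (use IH(1) in auto)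
  have ne: "?C \<noteq> {}"
    using IH(3) Suc.prems by (metis card.empty diff_is_0_eq not_less_eq_eq)
  \<comment> \<open>The infimum runs over all points beyond \<open>?e\<close>, possibly infinitely
    many. Some point lies in \<open>{?e<..b}\<close>, so only the finite set up to \<open>b\<close>
    matters and the infimum is attained there.\<close>
  have "Inf (A \<inter> {?e<..}) = Min ?C"
  proof (rule cInf_eq_minimum)
    show "Min ?C \<in> A \<inter> {?e<..}" using Min_in[OF fin ne] by auto
    fix x assume "x \<in> A \<inter> {?e<..}"
    then show "Min ?C \<le> x"
      using Min_le[OF fin, of x] Min_in[OF fin ne] by (cases "x \<le> b") auto
  qed
  then have e: "event_time A s (Suc n) = Min ?C" by simp
  have "A \<inter> {Min ?C<..b} = ?C - {Min ?C}"
    using Min_in[OF fin ne] Min_le[OF fin] by (force simp: less_le)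
  then have "card (A \<inter> {Min ?C<..b}) = card ?C - 1"
    using Min_in[OF fin ne] by simp
  then show ?case
    unfolding e using IH Min_in[OF fin ne] by auto
qed

lemma event_time_last:
  assumes "finite (A \<inter> {s<..b})" "s \<le> b" "card (A \<inter> {s<..b}) = n"
  shows "s \<le> event_time A s n" "event_time A s n \<le> b" "A \<inter> {event_time A s n<..b} = {}"
proof -
  note * = event_time_bounds[OF assms(1,2), of n]
  show 1: "s \<le> event_time A s n" "event_time A s n \<le> b" using * assms by auto
  have "finite (A \<inter> {event_time A s n<..b})"
    by (rule finite_subset[OF _ assms(1)]) (use 1 in auto)
  then show "A \<inter> {event_time A s n<..b} = {}" using * assms by simp
qed

lemma num_events_add:
  assumes "finite (E w \<inter> {a<..c})" "a \<le> b" "b \<le> c"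
  shows "num_events E a c w = num_events E a b w + num_events E b c w"
proof -
  have "E w \<inter> {a<..c} = (E w \<inter> {a<..b}) \<union> (E w \<inter> {b<..c})" using assms by auto
  moreover have "finite (E w \<inter> {a<..b})" "finite (E w \<inter> {b<..c})"
    using assms by (auto intro: finite_subset[OF _ assms(1)])
  ultimately show ?thesis
    unfolding num_events_def by (simp add: card_Un_disjoint disjoint_iff)
qed

section \<open>Finite-dimensional distributions\<close>

text \<open>Joint probability of the event counts \<open>k\<close> and the labels \<open>a\<close>
  at the times \<open>t 0, ..., t m\<close>. The number of events in \<open>{t 0<..t j}\<close> is
  \<open>\<Sum>i<j. k i\<close>, so the label at \<open>t j\<close> is the entry of the jump chain
  at that index; \<open>\<alpha>\<close> runs over the label paths of the chain from
  \<open>t 0\<close> on.\<close>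

definition fdd_term ::
  "(real \<Rightarrow> real) \<Rightarrow> 'e pmf \<Rightarrow> ('e \<Rightarrow> 'e pmf) \<Rightarrow> (nat \<Rightarrow> real) \<Rightarrow> nat \<Rightarrow> (nat \<Rightarrow> 'e) \<Rightarrow> (nat \<Rightarrow> nat) \<Rightarrow> real"
where
  "fdd_term lam ini tr t m a k =
     (\<Prod>j<m. pmf (poisson_pmf (cumulative_rate lam (t j) (t (Suc j)))) (k j)) *
     (\<Sum>\<alpha> | \<alpha> \<in> PiE {..\<Sum>i<m. k i} (\<lambda>_. set_pmf ini) \<and> (\<forall>j\<le>m. \<alpha> (\<Sum>i<j. k i) = a j).
        path_weight ini tr (\<Sum>i<m. k i) \<alpha>)"

definition counts_event ::
  "'w measure \<Rightarrow> ('w \<Rightarrow> real set) \<Rightarrow> (nat \<Rightarrow> real) \<Rightarrow> nat \<Rightarrow> (nat \<Rightarrow> nat) \<Rightarrow> 'w set"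
where
  "counts_event M E t m k = {w\<in>space M. \<forall>j<m. num_events E (t j) (t (Suc j)) w = k j}"

text \<open>The witness \<open>E\<close> of \<open>switching_process\<close> becomes a parameter,
  and \<open>f\<close> labels the states. Only \<open>lam\<close>, \<open>ini\<close> and
  \<open>tr\<close> have to be shared by two instances for their label processes to be
  comparable.\<close>

locale lumped_switching = prob_space M for M :: "'w measure" +
  fixes lam :: "real \<Rightarrow> real" and S :: "'d set" and ch :: "'d \<Rightarrow> 'd set"
    and D :: "real \<Rightarrow> 'w \<Rightarrow> 'd" and f :: "'d \<Rightarrow> 'e"
    and ini :: "'e pmf" and tr :: "'e \<Rightarrow> 'e pmf" and E :: "'w \<Rightarrow> real set"
  assumes finite_S: "finite S" and S_nonempty: "S \<noteq> {}"
    and ch: "d \<in> S \<Longrightarrow> ch d \<subseteq> S \<and> ch d \<noteq> {}"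
    and lump_ini: "map_pmf f (pmf_of_set S) = ini"
    and lump_tr: "d \<in> S \<Longrightarrow> map_pmf f (pmf_of_set (ch d)) = tr (f d)"
    and poisson: "poisson_events M lam E"
    and measurable_D: "t \<in> admissible_times lam \<Longrightarrow> D t \<in> measurable M (count_space S)"
    and D_const: "\<lbrakk>w \<in> space M; a \<in> admissible_times lam; a \<le> b; E w \<inter> {a<..b} = {}\<rbrakk>
        \<Longrightarrow> D b w = D a w"
    and D_law: "\<lbrakk>s \<in> admissible_times lam; A \<in> events_after M E s;
        \<And>w. w \<in> A \<Longrightarrow> \<exists>b. n \<le> num_events E s b w\<rbrakk> \<Longrightarrow>
        measure M (A \<inter> {w\<in>space M. \<forall>i\<le>n. D (event_time (E w) s i) w = x i})
          = measure M A * pmf (pmf_of_set S) (x 0)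
              * (\<Prod>i<n. pmf (pmf_of_set (ch (x i))) (x (Suc i)))"
begin

lemma admissible_pos: "0 < s \<Longrightarrow> s \<in> admissible_times lam"
  by (simp add: admissible_times_def)

lemma finite_events: "w \<in> space M \<Longrightarrow> 0 < a \<Longrightarrow> finite (E w \<inter> {a<..b})"
  using poisson admissible_pos unfolding poisson_events_def by blast

lemma set_pmf_ch: "d \<in> S \<Longrightarrow> set_pmf (pmf_of_set (ch d)) \<subseteq> S"
  using ch[of d] finite_S by (subst set_pmf_of_set) (auto intro: finite_subset)

lemma set_pmf_ini: "set_pmf ini = f ` S"
  using finite_S S_nonempty by (simp add: lump_ini[symmetric])

lemma D_in_S: "w \<in> space M \<Longrightarrow> 0 < t \<Longrightarrow> D t w \<in> S"
  using measurable_D[OF admissible_pos, of t] by (auto simp: measurable_def)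

context
  fixes t :: "nat \<Rightarrow> real" and m :: nat
  assumes t_pos: "0 < t 0" and t_mono: "\<And>i. i < m \<Longrightarrow> t i < t (Suc i)"
begin

lemma t_le: "i \<le> j \<Longrightarrow> j \<le> m \<Longrightarrow> t i \<le> t j"
proof (induction j rule: dec_induct)
  case (step j)
  then show ?case using t_mono[of j] by simp
qed simp

lemma t_all_pos: "j \<le> m \<Longrightarrow> 0 < t j"
  using t_le[of 0 j] t_pos by simp

lemma indep_counts:
  "indep_vars (\<lambda>_. count_space UNIV) (\<lambda>i. num_events E (t i) (t (Suc i))) {..<m}"
  using poisson t_mono admissible_pos[OF t_pos] unfolding poisson_events_def by blast

lemma counts_event_eq:
  "counts_event M E t m k
     = space M \<inter> (\<Inter>j\<in>{..<m}. {w\<in>space M. num_events E (t j) (t (Suc j)) w = k j})"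
  by (auto simp: counts_event_def)

lemma num_events_measurable:
  "j < m \<Longrightarrow> num_events E (t j) (t (Suc j)) \<in> measurable M (count_space UNIV)"
  using indep_counts unfolding indep_vars_def by auto

lemma counts_event_sets: "counts_event M E t m k \<in> sets M"
  unfolding counts_event_eq using num_events_measurable
  by (cases "m = 0") (auto intro!: sets.Int sets.finite_INT)

text \<open>\<open>D_law\<close> speaks only about events of the Poisson
  \<open>\<sigma>\<close>-algebra after the starting time, so plain measurability of the count event
  is not enough.\<close>

lemma counts_event_after: "counts_event M E t m k \<in> events_after M E (t 0)"
proof -
  let ?G = "{{w\<in>space M. num_events E a b w = k} | a b k. t 0 \<le> a \<and> a \<le> b}"
  have G: "?G \<subseteq> Pow (space M)" by auto
  interpret sigma_algebra "space M" "sigma_sets (space M) ?G"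
    by (rule sigma_algebra_sigma_sets[OF G])
  have "{w\<in>space M. num_events E (t j) (t (Suc j)) w = k j} \<in> sigma_sets (space M) ?G"
    if "j < m" for j
  proof (rule sigma_sets.Basic)
    have "t 0 \<le> t j" "t j \<le> t (Suc j)"
      using t_le[of 0 j] t_mono[of j] that by auto
    then show "{w\<in>space M. num_events E (t j) (t (Suc j)) w = k j} \<in> ?G" by blast
  qed
  then show ?thesis
    unfolding counts_event_eq events_after_def
    by (cases "m = 0") (simp add: sigma_sets_top, intro Int[OF top] finite_INT, auto)
qed

lemma prob_counts_event:
  "prob (counts_event M E t m k)
     = (\<Prod>j<m. pmf (poisson_pmf (cumulative_rate lam (t j) (t (Suc j)))) (k j))"
proof (cases "m = 0")
  case True
  then show ?thesis by (simp add: counts_event_def prob_space)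
next
  case False
  have "prob (\<Inter>j\<in>{..<m}. num_events E (t j) (t (Suc j)) -` {k j} \<inter> space M)
      = (\<Prod>j<m. prob (num_events E (t j) (t (Suc j)) -` {k j} \<inter> space M))"
    by (rule indep_varsD[OF indep_counts]) (use False in auto)
  moreover have "counts_event M E t m k = (\<Inter>j\<in>{..<m}. num_events E (t j) (t (Suc j)) -` {k j} \<inter> space M)"
    using False by (auto simp: counts_event_def)
  moreover have "prob (num_events E (t j) (t (Suc j)) -` {k j} \<inter> space M)
      = pmf (poisson_pmf (cumulative_rate lam (t j) (t (Suc j)))) (k j)" if "j < m" for j
  proof -
    have "num_events E (t j) (t (Suc j)) -` {k j} \<inter> space M
        = {w\<in>space M. num_events E (t j) (t (Suc j)) w = k j}" by auto
    then show ?thesis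
      using poisson t_mono[OF that] admissible_pos[OF t_all_pos, of j] that
      unfolding poisson_events_def by auto
  qed
  ultimately show ?thesis by simp
qed

lemma num_events_total:
  assumes "w \<in> counts_event M E t m k" "j \<le> m"
  shows "num_events E (t 0) (t j) w = (\<Sum>i<j. k i)"
  using assms(2)
proof (induction j)
  case 0
  then show ?case by (simp add: num_events_def)
next
  case (Suc j)
  have w: "w \<in> space M" "num_events E (t j) (t (Suc j)) w = k j"
    using assms(1) Suc.prems by (auto simp: counts_event_def)
  show ?case
    using Suc w num_events_add[of E w "t 0" "t (Suc j)" "t j"] finite_events[OF w(1) t_pos]
      t_le[of 0 j] t_le[of j "Suc j"] by simp
qed

text \<open>No event separates \<open>t j\<close> from the last event in \<open>{t 0<..t j}\<close>
  (or from \<open>t 0\<close> if there is none), and the counts say which index that event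
  has.\<close>

lemma D_at_grid:
  assumes w: "w \<in> counts_event M E t m k" and j: "j \<le> m"
  shows "D (t j) w = D (event_time (E w) (t 0) (\<Sum>i<j. k i)) w"
proof -
  have sp: "w \<in> space M" using w by (simp add: counts_event_def)
  have c: "card (E w \<inter> {t 0<..t j}) = (\<Sum>i<j. k i)"
    using num_events_total[OF w j] by (simp add: num_events_def)
  note * = event_time_last[OF finite_events[OF sp t_pos] t_le[OF le0 j] c]
  show ?thesis
    by (rule D_const[OF sp admissible_pos]) (use * t_pos in auto)
qed

text \<open>The count event is cut into pieces on which the values at the successive event times
  follow a fixed path. \<open>D_law\<close> gives each piece its chain weight, and the label
  condition selects whole pieces. Measurability comes along because the partition argument needs
  it.\<close>

lemma prob_counts_labels:
  "{w \<in> counts_event M E t m k. \<forall>j\<le>m. f (D (t j) w) = a j} \<in> sets M \<and>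
   prob {w \<in> counts_event M E t m k. \<forall>j\<le>m. f (D (t j) w) = a j} = fdd_term lam ini tr t m a k"
proof
  let ?B = "{w \<in> counts_event M E t m k. \<forall>j\<le>m. f (D (t j) w) = a j}"
  define K where "K j = (\<Sum>i<j. k i)" for j
  define n where "n = K m"
  have Kn: "K j \<le> n" if "j \<le> m" for j
    unfolding K_def n_def using that by (intro sum_mono2) auto
  \<comment> \<open>Expressed through the fixed times \<open>t j\<close>, the event is measurable,
    in contrast to the pieces \<open>X d\<close> below, which involve \<open>D\<close> at random
    times.\<close>
  have eq: "?B = counts_event M E t m k \<inter> (\<Inter>j\<in>{..m}. D (t j) -` {d\<in>S. f d = a j} \<inter> space M)"
    using D_in_S t_all_pos by (auto simp: counts_event_def)
  have "(\<Inter>j\<in>{..m}. D (t j) -` {d\<in>S. f d = a j} \<inter> space M) \<in> sets M"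
  proof (intro sets.finite_INT)
    fix j assume "j \<in> {..m}"
    then show "D (t j) -` {d\<in>S. f d = a j} \<inter> space M \<in> sets M"
      by (intro measurable_sets[OF measurable_D[OF admissible_pos[OF t_all_pos]]]) auto
  qed auto
  then show B: "?B \<in> sets M"
    unfolding eq using counts_event_sets by auto
  define X where
    "X d = counts_event M E t m k \<inter> {w\<in>space M. \<forall>i\<le>n. D (event_time (E w) (t 0) i) w = d i}" for d
  let ?w = "path_weight (pmf_of_set S) (\<lambda>d. pmf_of_set (ch d)) n"
  let ?P = "PiE {..n} (\<lambda>_. S)"
  let ?C = "\<lambda>a'. \<forall>j\<le>m. a' (K j) = a j"
  let ?Q = "{d \<in> ?P. ?C (\<lambda>i. f (d i))}"
  have X: "prob (X d) = prob (counts_event M E t m k) * ?w d" for d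
    unfolding X_def path_weight_def
    by (subst D_law[OF admissible_pos[OF t_pos] counts_event_after])
       (simp_all add: n_def K_def, metis num_events_total order_refl)
  have path: "\<exists>d\<in>?P. w \<in> X d" if w: "w \<in> counts_event M E t m k" for w
  proof
    let ?d = "\<lambda>i\<in>{..n}. D (event_time (E w) (t 0) i) w"
    have sp: "w \<in> space M" using w by (simp add: counts_event_def)
    show "w \<in> X ?d" using w sp by (auto simp: X_def)
    have "n = card (E w \<inter> {t 0<..t m})"
      using num_events_total[OF w order_refl] by (simp add: num_events_def n_def K_def)
    then have "t 0 \<le> event_time (E w) (t 0) i" if "i \<le> n" for i
      using event_time_bounds[OF finite_events[OF sp t_pos] t_le[OF le0 order_refl], of i] that
      by auto
    then have "D (event_time (E w) (t 0) i) w \<in> S" if "i \<le> n" for i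
      using that t_pos by (intro D_in_S[OF sp]) (meson less_le_trans)
    then show "?d \<in> ?P" by auto
  qed
  \<comment> \<open>On a piece, the label at \<open>t j\<close> is read off the path at index
    \<open>K j\<close>, the number of events that have occurred since \<open>t 0\<close>.\<close>
  have onX: "f (D (t j) w) = f (d (K j))" if "w \<in> X d" "j \<le> m" for w d j
    using that D_at_grid[of w k j] Kn[of j] by (auto simp: X_def K_def)
  have "prob ?B = prob (counts_event M E t m k) * sum ?w ?Q"
  proof (rule measure_disjoint_cover[OF _ _ counts_event_sets B])
    show "finite ?P" using finite_S by (auto intro: finite_PiE)
    show "disjoint_family_on X ?P"
      unfolding disjoint_family_on_def
    proof (intro ballI impI equals0I)
      fix d e w assume de: "d \<in> ?P" "e \<in> ?P" "d \<noteq> e" "w \<in> X d \<inter> X e"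
      have "d = e" by (rule PiE_ext[OF de(1,2)]) (use de(4) in \<open>auto simp: X_def\<close>)
      then show False using de by simp
    qed
    show "counts_event M E t m k = (\<Union>d\<in>?P. X d)"
      using path by (auto simp: X_def)
    show "?B = (\<Union>d\<in>?Q. X d)"
    proof (intro set_eqI iffI)
      fix w assume w: "w \<in> ?B"
      then obtain d where d: "d \<in> ?P" "w \<in> X d" using path by blast
      then have "d \<in> ?Q" using w onX[OF d(2)] by auto
      then show "w \<in> (\<Union>d\<in>?Q. X d)" using d by blast
    next
      fix w assume "w \<in> (\<Union>d\<in>?Q. X d)"
      then obtain d where d: "d \<in> ?Q" "w \<in> X d" by blast
      then show "w \<in> ?B" using onX[OF d(2)] by (auto simp: X_def)
    qed
    show "prob (X d) = prob (counts_event M E t m k) * ?w d" for d by (rule X)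
    show "sum ?w ?P = 1"
      using finite_S S_nonempty set_pmf_ch by (intro sum_path_weight) auto
  qed auto
  \<comment> \<open>Lumping passes from state paths to label paths; as the label set is the support
    of \<open>ini\<close>, the result is expressed by \<open>ini\<close> and \<open>tr\<close>
    alone.\<close>
  also have "sum ?w ?Q = (\<Sum>\<alpha> | \<alpha> \<in> PiE {..n} (\<lambda>_. f ` S) \<and> ?C \<alpha>. path_weight ini tr n \<alpha>)"
  proof (rule sum_path_weight_lumped[where C = ?C and f = f and k' = tr and p' = ini])
    show "?C e" if "\<And>i. i \<le> n \<Longrightarrow> d i = e i" "?C d" for d e
      using that Kn by metis
  qed (use finite_S S_nonempty set_pmf_ch lump_ini lump_tr in auto)
  finally show "prob ?B = fdd_term lam ini tr t m a k"
    by (simp add: prob_counts_event fdd_term_def set_pmf_ini n_def K_def)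
qed

text \<open>Summation over the countably many count vectors. The right-hand side contains neither
  the probability space nor the process, so any two instances with the same \<open>lam\<close>,
  \<open>ini\<close> and \<open>tr\<close> agree.\<close>

lemma finite_dim_distribution:
  "emeasure M {w\<in>space M. \<forall>j\<le>m. f (D (t j) w) = a j}
     = (\<integral>\<^sup>+k. ennreal (fdd_term lam ini tr t m a k) \<partial>count_space (PiE {..<m} (\<lambda>_. UNIV)))"
proof -
  let ?I = "PiE {..<m} (\<lambda>_. UNIV :: nat set)"
  let ?B = "\<lambda>k. {w \<in> counts_event M E t m k. \<forall>j\<le>m. f (D (t j) w) = a j}"
  have "{w\<in>space M. \<forall>j\<le>m. f (D (t j) w) = a j} = (\<Union>k\<in>?I. ?B k)"
  proof (intro set_eqI iffI)
    fix w assume w: "w \<in> {w\<in>space M. \<forall>j\<le>m. f (D (t j) w) = a j}"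
    let ?k = "\<lambda>j\<in>{..<m}. num_events E (t j) (t (Suc j)) w"
    have "w \<in> ?B ?k" using w by (auto simp: counts_event_def)
    then show "w \<in> (\<Union>k\<in>?I. ?B k)" by (intro UN_I[of ?k]) auto
  qed (auto simp: counts_event_def)
  also have "emeasure M \<dots> = (\<integral>\<^sup>+k. emeasure M (?B k) \<partial>count_space ?I)"
  proof (rule emeasure_UN_countable)
    show "countable ?I" by (intro countable_PiE) auto
    show "disjoint_family_on ?B ?I"
      unfolding disjoint_family_on_def
    proof (intro ballI impI equals0I)
      fix d e w assume de: "d \<in> ?I" "e \<in> ?I" "d \<noteq> e" "w \<in> ?B d \<inter> ?B e"
      have "d = e" by (rule PiE_ext[OF de(1,2)]) (use de(4) in \<open>auto simp: counts_event_def\<close>)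
      then show False using de by simp
    qed
  qed (rule conjunct1[OF prob_counts_labels])
  also have "\<dots> = (\<integral>\<^sup>+k. ennreal (fdd_term lam ini tr t m a k) \<partial>count_space ?I)"
    by (simp only: emeasure_eq_measure conjunct2[OF prob_counts_labels])
  finally show ?thesis .
qed

end

end

section \<open>Laws of path integrals\<close>

text \<open>Indicators of open sets are limits of continuous functions, and open sets form an
  intersection-stable generator. Continuous test functions suit the later use, where the laws to be
  compared arise from limits of random variables.\<close>

lemma measure_eqI_continuous:
  fixes P Q :: "'b::metric_space measure"
  assumes sets: "sets P = sets borel" "sets Q = sets borel"
    and fin: "finite_measure P" "finite_measure Q"
    and eq: "\<And>\<phi> :: 'b \<Rightarrow> real. continuous_on UNIV \<phi> \<Longrightarrow> (\<And>x. 0 \<le> \<phi> x \<and> \<phi> x \<le> 1)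
        \<Longrightarrow> integral\<^sup>L P \<phi> = integral\<^sup>L Q \<phi>"
  shows "P = Q"
proof (rule measure_eqI_generator_eq[where \<Omega> = UNIV and E = "{U. open U}" and A = "\<lambda>_. UNIV"])
  interpret P: finite_measure P by fact
  interpret Q: finite_measure Q by fact
  show "emeasure P U = emeasure Q U" if "U \<in> {U. open U}" for U
  proof (cases "U = UNIV")
    case True
    then show ?thesis
      using eq[of "\<lambda>_. 1"] sets_eq_imp_space_eq[OF sets(1)] sets_eq_imp_space_eq[OF sets(2)]
      by (simp add: P.emeasure_eq_measure Q.emeasure_eq_measure)
  next
    case False
    \<comment> \<open>Inside the open set the distance to its complement is positive, so
      \<open>\<phi> n\<close> eventually reaches 1. The whole space was split off because
      \<open>infdist\<close> to the empty set is 0.\<close>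
    define \<phi> where "\<phi> n x = min 1 (real n * infdist x (- U))" for n x
    have lim: "(\<lambda>n. \<phi> n x) \<longlonglongrightarrow> indicator U x" for x
    proof (cases "x \<in> U")
      case True
      then have pos: "infdist x (- U) > 0"
        using in_closed_iff_infdist_zero[of "- U" x] that False infdist_nonneg[of x "- U"]
        by (auto simp: less_le)
      obtain N where N: "real N * infdist x (- U) \<ge> 1"
        using reals_Archimedean3[OF pos] by (meson less_imp_le)
      have "\<phi> n x = 1" if "n \<ge> N" for n
      proof -
        have "real N * infdist x (- U) \<le> real n * infdist x (- U)"
          using that pos by simp
        then show ?thesis using N by (simp add: \<phi>_def)
      qed
      then have "eventually (\<lambda>n. \<phi> n x = 1) sequentially"
        by (auto simp: eventually_sequentially)
      then show ?thesis using True by (simp add: tendsto_eventually)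
    next
      case False
      then show ?thesis by (simp add: \<phi>_def)
    qed
    have cont: "continuous_on UNIV (\<phi> n)" for n
      unfolding \<phi>_def by (intro continuous_intros)
    have bnd: "0 \<le> \<phi> n x \<and> \<phi> n x \<le> 1" for n x
      by (simp add: \<phi>_def infdist_nonneg)
    have *: "(\<lambda>n. integral\<^sup>L N (\<phi> n)) \<longlonglongrightarrow> measure N U"
      if N: "sets N = sets borel" "finite_measure N" for N
    proof -
      interpret N: finite_measure N by fact
      have U: "U \<in> sets N" using \<open>U \<in> {U. open U}\<close> N by auto
      have "(\<lambda>n. integral\<^sup>L N (\<phi> n)) \<longlonglongrightarrow> integral\<^sup>L N (indicator U :: _ \<Rightarrow> real)"
      proof (rule integral_dominated_convergence[where w = "\<lambda>_. 1"])
        show "(indicator U :: _ \<Rightarrow> real) \<in> borel_measurable N" using U by simp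
        show "\<phi> n \<in> borel_measurable N" for n
          using borel_measurable_continuous_onI[OF cont] N(1) by (simp cong: measurable_cong_sets)
      qed (use lim bnd in auto)
      then show ?thesis using U sets.sets_into_space[OF U] by (simp add: Int_absorb2)
    qed
    have "measure P U = measure Q U"
      using *[OF sets(1) fin(1)] *[OF sets(2) fin(2)] eq[OF cont bnd]
      by (simp add: LIMSEQ_unique)
    then show ?thesis by (simp add: P.emeasure_eq_measure Q.emeasure_eq_measure)
  qed
  show "emeasure P UNIV \<noteq> \<infinity>" by simp
qed (use sets in \<open>auto simp: Int_stable_def borel_def\<close>)

section \<open>Approximating path integrals along a grid of positive times\<close>

definition grid :: "nat \<Rightarrow> nat \<Rightarrow> real" where
  "grid n j = (real j + 1) / (real n + 1)"

text \<open>Together with the shift by one in \<open>grid\<close>, this picks the first grid point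
  strictly to the right of \<open>u\<close>. All grid points are thus positive, and the
  approximation comes from the side on which paths are continuous.\<close>

definition grid_index :: "nat \<Rightarrow> real \<Rightarrow> nat" where
  "grid_index n u = nat \<lfloor>u * (real n + 1)\<rfloor>"

lemma grid_pos: "0 < grid n j"
  by (simp add: grid_def add_nonneg_pos)

lemma grid_mono: "i < j \<Longrightarrow> grid n i < grid n j"
  by (simp add: grid_def divide_strict_right_mono add_nonneg_pos)

lemma grid_index_mono: "u \<le> v \<Longrightarrow> grid_index n u \<le> grid_index n v"
  unfolding grid_index_def by (intro nat_mono floor_mono mult_right_mono) auto

lemma grid_bounds:
  assumes "0 \<le> u"
  shows "u < grid n (grid_index n u)" "grid n (grid_index n u) \<le> u + 1 / (real n + 1)"
proof -
  have eq: "real (grid_index n u) = of_int \<lfloor>u * (real n + 1)\<rfloor>"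
    using assms by (simp add: grid_index_def)
  have "u * (real n + 1) < real (grid_index n u) + 1"
    unfolding eq by linarith
  then show "u < grid n (grid_index n u)"
    by (simp add: grid_def pos_less_divide_eq add_nonneg_pos)
  have "real (grid_index n u) + 1 \<le> u * (real n + 1) + 1"
    unfolding eq by linarith
  then have "grid n (grid_index n u) \<le> (u * (real n + 1) + 1) / (real n + 1)"
    unfolding grid_def by (intro divide_right_mono) auto
  also have "\<dots> = u + 1 / (real n + 1)"
    by (simp add: field_simps)
  finally show "grid n (grid_index n u) \<le> u + 1 / (real n + 1)" .
qed

lemma measurable_grid_index [measurable]: "(\<lambda>u. g (grid_index n u)) \<in> measurable borel (count_space UNIV)"
proof -
  have "(\<lambda>u. \<lfloor>u * (real n + 1)\<rfloor>) \<in> measurable borel (count_space UNIV)"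
    by measurable
  from measurable_compose[OF this, of "\<lambda>i. g (nat i)" "count_space UNIV"]
  show ?thesis by (simp add: grid_index_def)
qed

context lumped_switching
begin

text \<open>Only finitely many events lie in \<open>{u<..u + 1}\<close>, so they keep a positive
  distance from \<open>u\<close>; once the mesh is finer, no event separates \<open>u\<close> from
  its grid point. Eventual equality replaces a limit because states carry no topology.\<close>

lemma D_grid_eventually:
  assumes w: "w \<in> space M" and u: "0 < u"
  shows "eventually (\<lambda>n. D (grid n (grid_index n u)) w = D u w) sequentially"
proof -
  obtain \<delta> where \<delta>: "\<delta> > 0" "\<And>x. x \<in> E w \<inter> {u<..u + 1} \<Longrightarrow> x \<noteq> u \<Longrightarrow> \<delta> \<le> dist u x"
    using finite_set_avoid[OF finite_events[OF w u], of "u + 1" u] by blast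
  have "(\<lambda>n. 1 / (real n + 1)) \<longlonglongrightarrow> 0"
    using LIMSEQ_inverse_real_of_nat by (simp add: inverse_eq_divide add.commute)
  then have "eventually (\<lambda>n. 1 / (real n + 1) < min \<delta> 1) sequentially"
    using \<delta>(1) by (intro order_tendstoD) auto
  then show ?thesis
  proof eventually_elim
    case (elim n)
    let ?g = "grid n (grid_index n u)"
    have g: "u < ?g" "?g < u + \<delta>" "?g < u + 1"
      using grid_bounds[of u n] u elim[unfolded min_less_iff_conj] by linarith+
    have "E w \<inter> {u<..?g} = {}"
    proof (rule equals0I)
      fix x assume x: "x \<in> E w \<inter> {u<..?g}"
      then have "\<delta> \<le> dist u x" using g by (intro \<delta>(2)) auto
      then show False using x g by (auto simp: dist_real_def)
    qed
    then show ?case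
      using D_const[OF w admissible_pos[OF u], of ?g] g by simp
  qed
qed

text \<open>Measurability of the path in \<open>u\<close> is a result here: the path is a pointwise
  limit of step functions. The finitely many values of \<open>h\<close> on labels give the
  dominating constant. Time 0 is left out, since \<open>D\<close> may be arbitrary there.\<close>

lemma path_integral:
  fixes h :: "'e \<Rightarrow> 'b::euclidean_space"
  assumes w: "w \<in> space M"
  shows "set_integrable lborel {0<..t} (\<lambda>u. h (f (D u w)))" (is ?integrable)
    and "(\<lambda>n. LINT u:{0<..t}|lborel. h (f (D (grid n (grid_index n u)) w)))
      \<longlonglongrightarrow> (LINT u:{0<..t}|lborel. h (f (D u w)))" (is ?limit)
proof -
  define B where "B = Max ((\<lambda>d. norm (h (f d))) ` S)"
  have B: "norm (h (f (D u w))) \<le> B" if "0 < u" for u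
    unfolding B_def using finite_S D_in_S[OF w that] by (intro Max_ge) auto
  let ?s = "\<lambda>n u. indicator {0<..t} u *\<^sub>R h (f (D (grid n (grid_index n u)) w))"
  let ?g = "\<lambda>u. indicator {0<..t} u *\<^sub>R h (f (D u w))"
  have s [measurable]: "?s n \<in> borel_measurable lborel" for n
    using measurable_compose[OF measurable_grid_index[of "\<lambda>j. h (f (D (grid n j) w))" n], of "\<lambda>x. x" borel]
    by simp
  have lim: "(\<lambda>n. ?s n u) \<longlonglongrightarrow> ?g u" for u
  proof (cases "u \<in> {0<..t}")
    case True
    then have "eventually (\<lambda>n. ?s n u = ?g u) sequentially"
      using D_grid_eventually[OF w, of u] by (auto elim: eventually_mono)
    then show ?thesis by (rule tendsto_eventually)
  qed simp
  have g [measurable]: "?g \<in> borel_measurable lborel"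
    by (rule borel_measurable_LIMSEQ_metric[OF s lim])
  have dom: "integrable lborel (\<lambda>u. indicator {0<..t} u * B)"
    by (intro integrable_mult_left integrable_real_indicator) (cases "0 \<le> t"; simp)+
  have "AE u in lborel. norm (?s n u) \<le> indicator {0<..t} u * B" for n
    using B[OF grid_pos] by (auto simp: indicator_def)
  note * = g s dom AE_I2[OF lim] this
  show ?integrable
    unfolding set_integrable_def by (rule integrable_dominated_convergence[OF *])
  show ?limit
    unfolding set_lebesgue_integral_def by (rule integral_dominated_convergence[OF *])
qed

text \<open>The restriction makes the values extensional functions, hence elements of a finite set,
  on which a law is determined by its point masses.\<close>

definition label_vector :: "nat \<Rightarrow> nat \<Rightarrow> 'w \<Rightarrow> nat \<Rightarrow> 'e" where
  "label_vector n K w = (\<lambda>j\<in>{..K}. f (D (grid n j) w))"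

lemma label_vector_vimage:
  assumes "a \<in> PiE {..K} (\<lambda>_. set_pmf ini)"
  shows "label_vector n K -` {a} \<inter> space M = {w\<in>space M. \<forall>j\<le>K. f (D (grid n j) w) = a j}"
  using assms by (auto simp: label_vector_def fun_eq_iff PiE_def extensional_def)

lemma measurable_label_vector:
  "label_vector n K \<in> measurable M (count_space (PiE {..K} (\<lambda>_. set_pmf ini)))"
proof (subst measurable_count_space_eq2)
  show "finite (PiE {..K} (\<lambda>_. set_pmf ini))"
    using finite_S by (intro finite_PiE) (auto simp: set_pmf_ini)
  have eq: "{w\<in>space M. \<forall>j\<le>K. f (D (grid n j) w) = a j}
      = space M \<inter> (\<Inter>j\<in>{..K}. D (grid n j) -` {d\<in>S. f d = a j} \<inter> space M)" for a
    using D_in_S[OF _ grid_pos] by auto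
  have ms: "D (grid n j) -` {d\<in>S. f d = a j} \<inter> space M \<in> sets M" for a j
    by (rule measurable_sets[OF measurable_D[OF admissible_pos[OF grid_pos]]]) simp
  have "{w\<in>space M. \<forall>j\<le>K. f (D (grid n j) w) = a j} \<in> sets M" for a
    unfolding eq by (intro sets.Int sets.top sets.finite_INT ms) auto
  moreover have "label_vector n K w \<in> PiE {..K} (\<lambda>_. set_pmf ini)" if "w \<in> space M" for w
    using D_in_S[OF that grid_pos] by (auto simp: label_vector_def set_pmf_ini)
  ultimately show "label_vector n K \<in> space M \<rightarrow> PiE {..K} (\<lambda>_. set_pmf ini) \<and>
      (\<forall>a\<in>PiE {..K} (\<lambda>_. set_pmf ini). label_vector n K -` {a} \<inter> space M \<in> sets M)"
    by (intro conjI funcsetI ballI) (simp_all only: label_vector_vimage)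
qed

text \<open>For \<open>u\<close> up to \<open>t\<close> the index is at most
  \<open>grid_index n t\<close>, so the step integral is a function of finitely many labels.\<close>

lemma grid_integral_label_vector:
  fixes h :: "'e \<Rightarrow> 'b::euclidean_space"
  shows "(LINT u:{0<..t}|lborel. h (f (D (grid n (grid_index n u)) w)))
    = (LINT u:{0<..t}|lborel. h (label_vector n (grid_index n t) w (grid_index n u)))"
  by (intro set_lebesgue_integral_cong) (auto simp: label_vector_def grid_index_mono)

lemma measurable_path_integral:
  fixes h :: "'e \<Rightarrow> 'b::euclidean_space"
  shows "(\<lambda>w. LINT u:{0<..t}|lborel. h (f (D u w))) \<in> borel_measurable M"
proof (rule borel_measurable_LIMSEQ_metric[OF _ path_integral(2)])
  show "(\<lambda>w. LINT u:{0<..t}|lborel. h (f (D (grid n (grid_index n u)) w))) \<in> borel_measurable M" for n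
    unfolding grid_integral_label_vector
    by (rule measurable_compose[OF measurable_label_vector]) simp
qed

end

lemma distr_label_vector_eq:
  assumes "lumped_switching M lam S ch D f ini tr E"
    and "lumped_switching M' lam S' ch' D' f' ini tr E'"
  shows "distr M (count_space (PiE {..K} (\<lambda>_. set_pmf ini)))
           (lumped_switching.label_vector D f n K)
       = distr M' (count_space (PiE {..K} (\<lambda>_. set_pmf ini)))
           (lumped_switching.label_vector D' f' n K)"
proof -
  interpret A: lumped_switching M lam S ch D f ini tr E by fact
  interpret B: lumped_switching M' lam S' ch' D' f' ini tr E' by fact
  let ?P = "PiE {..K} (\<lambda>_. set_pmf ini)"
  show ?thesis
  proof (rule measure_eqI_finite)
    show "finite ?P"
      using A.finite_S by (intro finite_PiE) (auto simp: A.set_pmf_ini)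
    fix a assume a: "a \<in> ?P"
    show "emeasure (distr M (count_space ?P) (A.label_vector n K)) {a}
        = emeasure (distr M' (count_space ?P) (B.label_vector n K)) {a}"
      using a A.finite_dim_distribution[of "grid n" K a] B.finite_dim_distribution[of "grid n" K a]
      by (simp add: emeasure_distr A.measurable_label_vector B.measurable_label_vector
          A.label_vector_vimage B.label_vector_vimage grid_pos grid_mono)
  qed auto
qed

text \<open>The step integrals of both processes are the same function of equally distributed label
  vectors; bounded continuous test functions carry this equality over to the limits.\<close>

lemma distr_path_integral_eq:
  fixes h :: "'e \<Rightarrow> 'b::euclidean_space"
  assumes "lumped_switching M lam S ch D f ini tr E"
    and "lumped_switching M' lam S' ch' D' f' ini tr E'"
  shows "distr M borel (\<lambda>w. LINT u:{0<..t}|lborel. h (f (D u w)))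
       = distr M' borel (\<lambda>w. LINT u:{0<..t}|lborel. h (f' (D' u w)))"
proof -
  interpret A: lumped_switching M lam S ch D f ini tr E by fact
  interpret B: lumped_switching M' lam S' ch' D' f' ini tr E' by fact
  note [measurable] = A.measurable_path_integral B.measurable_path_integral
  show ?thesis
  proof (rule measure_eqI_continuous)
    show "finite_measure (distr M borel (\<lambda>w. LINT u:{0<..t}|lborel. h (f (D u w))))"
      by (intro A.finite_measure_distr) simp
    show "finite_measure (distr M' borel (\<lambda>w. LINT u:{0<..t}|lborel. h (f' (D' u w))))"
      by (intro B.finite_measure_distr) simp
    fix \<phi> :: "'b \<Rightarrow> real"
    assume cont: "continuous_on UNIV \<phi>" and bnd: "\<And>x. 0 \<le> \<phi> x \<and> \<phi> x \<le> 1"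
    have \<phi> [measurable]: "\<phi> \<in> borel_measurable borel"
      by (rule borel_measurable_continuous_onI[OF cont])
    let ?G = "\<lambda>n x. LINT u:{0<..t}|lborel. h (x (grid_index n u))"
    let ?K = "\<lambda>n. grid_index n t"
    let ?C = "\<lambda>n. count_space (PiE {..?K n} (\<lambda>_. set_pmf ini))"
    \<comment> \<open>Stated for an arbitrary instance, as both processes need it.
      \<open>?G n\<close> and \<open>?C n\<close> do not depend on the instance, so both sequences
      coincide once the label vectors have equal laws.\<close>
    have lim: "(\<lambda>n. \<integral>x. \<phi> (?G n x) \<partial>distr M (?C n) (lumped_switching.label_vector D f n (?K n)))
        \<longlonglongrightarrow> (\<integral>w. \<phi> (LINT u:{0<..t}|lborel. h (f (D u w))) \<partial>M)"
      if "lumped_switching M lam S ch D f ini tr E"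
      for M :: "'z measure" and lam S ch E and D :: "real \<Rightarrow> 'z \<Rightarrow> 'y" and f
    proof -
      interpret lumped_switching M lam S ch D f ini tr E by fact
      note [measurable] = measurable_path_integral
      let ?V = "\<lambda>n w. LINT u:{0<..t}|lborel. h (f (D (grid n (grid_index n u)) w))"
      have V: "?V n \<in> borel_measurable M" for n
        unfolding grid_integral_label_vector
        by (rule measurable_compose[OF measurable_label_vector]) simp
      have "(\<lambda>n. \<integral>w. \<phi> (?V n w) \<partial>M) \<longlonglongrightarrow> (\<integral>w. \<phi> (LINT u:{0<..t}|lborel. h (f (D u w))) \<partial>M)"
      proof (rule integral_dominated_convergence[where w = "\<lambda>_. 1"])
        show "AE w in M. (\<lambda>n. \<phi> (?V n w)) \<longlonglongrightarrow> \<phi> (LINT u:{0<..t}|lborel. h (f (D u w)))"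
        proof (rule AE_I2)
          fix w assume "w \<in> space M"
          then show "(\<lambda>n. \<phi> (?V n w)) \<longlonglongrightarrow> \<phi> (LINT u:{0<..t}|lborel. h (f (D u w)))"
            using continuous_on_tendsto_compose[OF cont path_integral(2)] by simp
        qed
        show "(\<lambda>w. \<phi> (?V n w)) \<in> borel_measurable M" for n
          using V by measurable
      qed (use bnd in auto)
      moreover have "(\<integral>w. \<phi> (?V n w) \<partial>M) = (\<integral>x. \<phi> (?G n x) \<partial>distr M (?C n) (label_vector n (?K n)))" for n
        unfolding grid_integral_label_vector
        by (subst integral_distr[OF measurable_label_vector]) auto
      ultimately show ?thesis by simp
    qed
    have "(\<integral>w. \<phi> (LINT u:{0<..t}|lborel. h (f (D u w))) \<partial>M)
        = (\<integral>w. \<phi> (LINT u:{0<..t}|lborel. h (f' (D' u w))) \<partial>M')"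
      using lim[OF assms(1)] lim[OF assms(2)] distr_label_vector_eq[OF assms]
      by (simp add: LIMSEQ_unique)
    then show "integral\<^sup>L (distr M borel (\<lambda>w. LINT u:{0<..t}|lborel. h (f (D u w)))) \<phi>
        = integral\<^sup>L (distr M' borel (\<lambda>w. LINT u:{0<..t}|lborel. h (f' (D' u w)))) \<phi>"
      by (simp add: integral_distr)
  qed auto
qed

section \<open>Change of variables\<close>

text \<open>This is \<open>s *\<^sub>R vel0 c + r *\<^sub>R vel1 c + (t - s - r) *\<^sub>R vel2
  c\<close> for \<open>x = (s, r)\<close>: the position after spending these times with the three
  velocities.\<close>

definition plane_position :: "real \<Rightarrow> real \<Rightarrow> real \<times> real \<Rightarrow> real \<times> real" where
  "plane_position c t x = (c / 2 * (3 * fst x - t), sqrt 3 * c / 2 * (fst x + 2 * snd x - t))"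

definition simplex_position :: "real \<Rightarrow> real \<Rightarrow> real \<times> real \<Rightarrow> real \<times> real" where
  "simplex_position c t y =
     ((2 * fst y / c + t) / 3, (2 * snd y / (sqrt 3 * c) - (2 * fst y / c + t) / 3 + t) / 2)"

lemma simplex_plane_position [simp]: "c > 0 \<Longrightarrow> simplex_position c t (plane_position c t x) = x"
  by (cases x) (simp add: simplex_position_def plane_position_def)

lemma plane_simplex_position [simp]: "c > 0 \<Longrightarrow> plane_position c t (simplex_position c t y) = y"
  by (cases y) (simp add: simplex_position_def plane_position_def field_simps)

lemma continuous_plane_position [continuous_intros]: "continuous_on A (plane_position c t)"
  unfolding plane_position_def by (intro continuous_intros)

lemma continuous_simplex_position: "c > 0 \<Longrightarrow> continuous_on A (simplex_position c t)"
  unfolding simplex_position_def by (intro continuous_intros) auto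

lemma measurable_plane_position [measurable]: "plane_position c t \<in> borel_measurable borel"
  by (rule borel_measurable_continuous_onI[OF continuous_plane_position])

lemma measurable_simplex_position: "c > 0 \<Longrightarrow> simplex_position c t \<in> borel_measurable borel"
  by (rule borel_measurable_continuous_onI[OF continuous_simplex_position])

lemma plane_position_image: "c > 0 \<Longrightarrow> plane_position c t ` B = simplex_position c t -` B"
  by (auto simp: image_iff) (metis plane_simplex_position)

text \<open>The affine map is triangular: the first coordinate depends on \<open>s\<close> only and
  scales by \<open>3 * c / 2\<close>, and for fixed \<open>s\<close> the second scales by
  \<open>sqrt 3 * c\<close> in \<open>r\<close>. The constant is the product of these
  factors.\<close>

lemma nn_integral_plane_position:
  fixes g :: "real \<times> real \<Rightarrow> ennreal"
  assumes "c > 0" and [measurable]: "g \<in> borel_measurable borel"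
  shows "(\<integral>\<^sup>+y. g y \<partial>lborel) = (\<integral>\<^sup>+x. ennreal (3 * sqrt 3 * c\<^sup>2 / 2) * g (plane_position c t x) \<partial>lborel)"
proof -
  have iter: "(\<integral>\<^sup>+y. f y \<partial>lborel) = (\<integral>\<^sup>+u. \<integral>\<^sup>+v. f (u, v) \<partial>lborel \<partial>lborel)"
    if [measurable]: "f \<in> borel_measurable borel" for f :: "real \<times> real \<Rightarrow> ennreal"
    unfolding lborel_prod[symmetric]
    by (rule lborel.nn_integral_fst[symmetric]) (simp add: lborel_prod)
  have "(\<integral>\<^sup>+y. g y \<partial>lborel) = (\<integral>\<^sup>+u. \<integral>\<^sup>+v. g (u, v) \<partial>lborel \<partial>lborel)"
    by (rule iter) simp
  also have "\<dots> = ennreal (3 * c / 2) * (\<integral>\<^sup>+s. \<integral>\<^sup>+v. g (- (c * t / 2) + 3 * c / 2 * s, v) \<partial>lborel \<partial>lborel)"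
    using assms(1) by (subst nn_integral_real_affine[where c = "3 * c / 2" and t = "- (c * t / 2)"])
      (auto simp: abs_of_pos)
  also have "\<dots> = ennreal (3 * c / 2) * (\<integral>\<^sup>+s. ennreal (sqrt 3 * c) * (\<integral>\<^sup>+r. g (plane_position c t (s, r)) \<partial>lborel) \<partial>lborel)"
  proof (intro arg_cong2[where f = "(*)"] refl nn_integral_cong)
    fix s
    have "(\<integral>\<^sup>+v. g (- (c * t / 2) + 3 * c / 2 * s, v) \<partial>lborel)
        = ennreal (sqrt 3 * c) * (\<integral>\<^sup>+r. g (- (c * t / 2) + 3 * c / 2 * s,
            sqrt 3 * c / 2 * (s - t) + sqrt 3 * c * r) \<partial>lborel)"
      using assms(1)
      by (subst nn_integral_real_affine[where c = "sqrt 3 * c" and t = "sqrt 3 * c / 2 * (s - t)"])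
        (auto simp: abs_of_pos)
    also have "(\<lambda>r. g (- (c * t / 2) + 3 * c / 2 * s, sqrt 3 * c / 2 * (s - t) + sqrt 3 * c * r))
        = (\<lambda>r. g (plane_position c t (s, r)))"
      by (intro ext arg_cong[where f = g]) (simp add: plane_position_def field_simps)
    finally show "(\<integral>\<^sup>+v. g (- (c * t / 2) + 3 * c / 2 * s, v) \<partial>lborel)
        = ennreal (sqrt 3 * c) * (\<integral>\<^sup>+r. g (plane_position c t (s, r)) \<partial>lborel)" .
  qed
  also have "\<dots> = (\<integral>\<^sup>+s. \<integral>\<^sup>+r. ennreal (3 * c / 2) * ennreal (sqrt 3 * c) * g (plane_position c t (s, r)) \<partial>lborel \<partial>lborel)"
    by (simp add: nn_integral_cmult mult.assoc)
  also have "ennreal (3 * c / 2) * ennreal (sqrt 3 * c) = ennreal (3 * sqrt 3 * c\<^sup>2 / 2)"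
    using assms(1) by (simp add: ennreal_mult[symmetric] power2_eq_square field_simps)
  also have "(\<integral>\<^sup>+s. \<integral>\<^sup>+r. ennreal (3 * sqrt 3 * c\<^sup>2 / 2) * g (plane_position c t (s, r)) \<partial>lborel \<partial>lborel)
      = (\<integral>\<^sup>+x. ennreal (3 * sqrt 3 * c\<^sup>2 / 2) * g (plane_position c t x) \<partial>lborel)"
    by (rule iter[symmetric]) measurable
  finally show ?thesis .
qed

lemma open_open_simplex: "open (open_simplex t)"
  unfolding open_simplex_def case_prod_unfold
  by (intro open_Collect_conj open_Collect_less continuous_intros)

text \<open>The fractions \<open>s / t\<close>, \<open>r / t\<close> and
  \<open>(t - s - r) / t\<close> of time are barycentric coordinates, so the image lies in the hull.
  It is open, as a preimage under the continuous inverse, and hence lies in the interior.\<close>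

lemma plane_position_simplex_subset:
  assumes "c > 0"
  shows "plane_position c t ` open_simplex t \<subseteq> open_triangle c t"
  unfolding open_triangle_def
proof (rule interior_maximal)
  show "open (plane_position c t ` open_simplex t)"
    unfolding plane_position_image[OF assms]
    using open_vimage[OF open_open_simplex continuous_simplex_position[OF assms]] by simp
  show "plane_position c t ` open_simplex t \<subseteq> convex hull {t *\<^sub>R vel0 c, t *\<^sub>R vel1 c, t *\<^sub>R vel2 c}"
  proof (clarsimp simp: open_simplex_def)
    fix s r :: real assume sr: "0 < s" "0 < r" "s + r < t"
    have t: "t > 0" using sr by simp
    have "plane_position c t (s, r)
        = (s / t) *\<^sub>R (t *\<^sub>R vel0 c) + (r / t) *\<^sub>R (t *\<^sub>R vel1 c) + ((t - s - r) / t) *\<^sub>R (t *\<^sub>R vel2 c)"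
      using t by (simp add: plane_position_def vel0_def vel1_def vel2_def field_simps)
    moreover have "s / t + r / t + (t - s - r) / t = 1" using t by (simp add: field_simps)
    ultimately show "plane_position c t (s, r) \<in> convex hull {t *\<^sub>R vel0 c, t *\<^sub>R vel1 c, t *\<^sub>R vel2 c}"
      unfolding convex_hull_3 using sr t by (intro CollectI exI conjI) auto
  qed
qed

text \<open>Both functions describe the same measure \<open>P\<close>, one directly and one through
  the affine map, so the claim is uniqueness of Lebesgue densities after a change of
  variables.\<close>

lemma density_transfer:
  fixes P :: "(real \<times> real) measure"
  assumes c: "c > 0" and P: "sets P = sets borel"
    and p: "density_on (emeasure P) (open_simplex t) p"
    and q: "ac_density_on (\<lambda>B. emeasure P (plane_position c t -` B)) (open_triangle c t) q"
  shows "AE x in lborel. x \<in> open_simplex t \<longrightarrow> p x = 3 * sqrt 3 * c\<^sup>2 / 2 * q (plane_position c t x)"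
proof -
  let ?A = "plane_position c t"
  let ?J = "3 * sqrt 3 * c\<^sup>2 / 2"
  obtain N where N: "N \<in> null_sets lborel"
    and q: "density_on (\<lambda>B. emeasure P (?A -` B)) (open_triangle c t - N) q"
    using q by (auto simp: ac_density_on_def)
  have [measurable]: "N \<in> sets borel" "open_simplex t \<in> sets borel" "open_triangle c t \<in> sets borel"
    using N open_open_simplex by (auto simp: open_triangle_def)
  \<comment> \<open>The part of the simplex on which both descriptions of \<open>P\<close> are
    available.\<close>
  define C where "C = open_simplex t - ?A -` N"
  have vim [measurable]: "?A -` B \<in> sets borel" if [measurable]: "B \<in> sets borel" for B
    using measurable_sets[OF measurable_plane_position that, of c t] by simp
  have C [measurable]: "C \<in> sets borel" unfolding C_def by measurable
  have AC: "?A x \<in> open_triangle c t - N" if "x \<in> C" for x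
    using that plane_position_simplex_subset[OF c, of t] by (auto simp: C_def)
  \<comment> \<open>\<open>density_on\<close> gives measurability only on a restricted space;
    extending by zero yields Borel functions on the plane.\<close>
  define P' where "P' x = ennreal (p x) * indicator (open_simplex t) x" for x
  define Q' where "Q' y = ennreal (q y) * indicator (open_triangle c t - N) y" for y
  have P' [measurable]: "P' \<in> borel_measurable borel"
  proof -
    have "p \<in> borel_measurable (restrict_space borel (open_simplex t))"
      using p unfolding density_on_def by blast
    then have "(\<lambda>x. ennreal (p x)) \<in> borel_measurable (restrict_space borel (open_simplex t))"
      by measurable
    then have "(\<lambda>x. ennreal (p x) * indicator (open_simplex t) x) \<in> borel_measurable borel"
      by (rule borel_measurable_restrict_space_iff_ennreal[THEN iffD1, rotated]) simp
    then show ?thesis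
      by (simp only: P'_def[abs_def])
  qed
  have Q' [measurable]: "Q' \<in> borel_measurable borel"
  proof -
    have "q \<in> borel_measurable (restrict_space borel (open_triangle c t - N))"
      using q unfolding density_on_def by blast
    then have "(\<lambda>x. ennreal (q x)) \<in> borel_measurable (restrict_space borel (open_triangle c t - N))"
      by measurable
    then have "(\<lambda>x. ennreal (q x) * indicator (open_triangle c t - N) x) \<in> borel_measurable borel"
      by (rule borel_measurable_restrict_space_iff_ennreal[THEN iffD1, rotated]) simp
    then show ?thesis
      by (simp only: Q'_def[abs_def])
  qed
  have "density lborel (\<lambda>x. P' x * indicator C x)
      = density lborel (\<lambda>x. ennreal ?J * Q' (?A x) * indicator C x)"
  proof (rule measure_eqI)
    fix B assume "B \<in> sets (density lborel (\<lambda>x. P' x * indicator C x))"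
    then have B [measurable]: "B \<in> sets borel" by simp
    have B' [measurable]: "?A ` (B \<inter> C) \<in> sets borel"
      unfolding plane_position_image[OF c]
      using measurable_sets[OF measurable_simplex_position[OF c], of "B \<inter> C" t] by simp
    have inj: "inj ?A"
      by (rule inj_on_inverseI) (rule simplex_plane_position[OF c])
    have "emeasure (density lborel (\<lambda>x. P' x * indicator C x)) B
        = (\<integral>\<^sup>+x. P' x * indicator C x * indicator B x \<partial>lborel)"
      by (simp add: emeasure_density)
    also have "\<dots> = (\<integral>\<^sup>+x\<in>B \<inter> C. ennreal (p x) \<partial>lborel)"
      by (intro nn_integral_cong) (auto simp: P'_def C_def indicator_def)
    also have "\<dots> = emeasure P (B \<inter> C)"
    proof -
      have "B \<inter> C \<subseteq> open_simplex t" by (auto simp: C_def)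
      moreover have "B \<inter> C \<in> sets borel" by measurable
      ultimately show ?thesis using p unfolding density_on_def by simp
    qed
    \<comment> \<open>By injectivity the test set is the preimage of its image, the form to which
      the density \<open>q\<close> applies.\<close>
    also have "B \<inter> C = ?A -` (?A ` (B \<inter> C))"
      by (rule inj_vimage_image_eq[OF inj, symmetric])
    also have "emeasure P \<dots> = (\<integral>\<^sup>+y\<in>?A ` (B \<inter> C). ennreal (q y) \<partial>lborel)"
    proof -
      have "?A ` (B \<inter> C) \<subseteq> open_triangle c t - N" using AC by auto
      then show ?thesis using q B' unfolding density_on_def by simp
    qed
    also have "\<dots> = (\<integral>\<^sup>+y. Q' y * indicator (?A ` (B \<inter> C)) y \<partial>lborel)"
      using AC by (intro nn_integral_cong) (auto simp: Q'_def indicator_def)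
    also have "\<dots> = (\<integral>\<^sup>+x. ennreal ?J * (Q' (?A x) * indicator (?A ` (B \<inter> C)) (?A x)) \<partial>lborel)"
      by (rule nn_integral_plane_position[OF c]) measurable
    also have "\<dots> = (\<integral>\<^sup>+x. ennreal ?J * Q' (?A x) * indicator C x * indicator B x \<partial>lborel)"
      by (intro nn_integral_cong) (auto simp: indicator_def inj_image_mem_iff[OF inj] mult.assoc)
    also have "\<dots> = emeasure (density lborel (\<lambda>x. ennreal ?J * Q' (?A x) * indicator C x)) B"
      by (simp add: emeasure_density)
    finally show "emeasure (density lborel (\<lambda>x. P' x * indicator C x)) B
        = emeasure (density lborel (\<lambda>x. ennreal ?J * Q' (?A x) * indicator C x)) B" .
  qed simp
  then have "AE x in lborel. P' x * indicator C x = ennreal ?J * Q' (?A x) * indicator C x"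
    by (subst (asm) sigma_finite_measure.density_unique_iff[OF lborel.sigma_finite_measure_axioms]) auto
  \<comment> \<open>The change of variables applied to \<open>indicator N\<close> shows that the
    preimage of \<open>N\<close> is null, so \<open>C\<close> is almost all of the simplex.\<close>
  moreover have "AE x in lborel. x \<notin> ?A -` N"
  proof (rule AE_not_in, rule null_setsI)
    have "0 = (\<integral>\<^sup>+y. indicator N y \<partial>lborel)"
      using N by (simp add: null_setsD1)
    also have "\<dots> = (\<integral>\<^sup>+x. ennreal ?J * indicator N (?A x) \<partial>lborel)"
      by (rule nn_integral_plane_position[OF c]) measurable
    also have "\<dots> = (\<integral>\<^sup>+x. ennreal ?J * indicator (?A -` N) x \<partial>lborel)"
      by (intro nn_integral_cong) (simp add: indicator_def)
    also have "\<dots> = ennreal ?J * emeasure lborel (?A -` N)"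
      by (subst nn_integral_cmult_indicator) auto
    finally show "emeasure lborel (?A -` N) = 0" using c by auto
  qed simp
  ultimately show ?thesis
  proof eventually_elim
    case (elim x)
    show ?case
    proof
      assume "x \<in> open_simplex t"
      then have x: "x \<in> C" using elim by (simp add: C_def)
      have "0 \<le> p x" "0 \<le> q (?A x)"
        using p q AC[OF x] \<open>x \<in> open_simplex t\<close> unfolding density_on_def by auto
      then show "p x = ?J * q (?A x)"
        using elim(1) x AC[OF x] \<open>x \<in> open_simplex t\<close>
        by (simp add: P'_def Q'_def ennreal_mult[symmetric])
    qed
  qed
qed

text \<open>The set where the functions differ is open in \<open>U\<close>, and a nonempty open set
  is not null.\<close>

lemma continuous_on_AE_eq:
  fixes f g :: "'b::euclidean_space \<Rightarrow> real"
  assumes U: "open U" and f: "continuous_on U f" and g: "continuous_on U g"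
    and AE: "AE x in lborel. x \<in> U \<longrightarrow> f x = g x" and x: "x \<in> U"
  shows "f x = g x"
proof (rule ccontr)
  assume ne: "f x \<noteq> g x"
  let ?D = "U \<inter> (\<lambda>x. f x - g x) -` (- {0})"
  have D: "open ?D"
    by (rule continuous_open_preimage[OF _ U]) (auto intro!: continuous_intros f g)
  have "x \<in> ?D" using x ne by simp
  then have "?D \<noteq> {}" by blast
  then have "\<not> negligible ?D" by (rule open_not_negligible[OF D])
  moreover have "AE x in lborel. x \<notin> ?D" using AE by eventually_elim auto
  then have "?D \<in> null_sets lborel"
    using D by (subst AE_iff_null_sets) auto
  then have "negligible ?D"
    by (simp add: negligible_iff_null_sets null_sets_completionI)
  ultimately show False by simp
qed

section \<open>Axes and planar velocities\<close>

lemma map_pmf_of_set_uniform: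
  assumes "finite A" "A \<noteq> {}" "f ` A = B"
    and card: "\<And>b. b \<in> B \<Longrightarrow> card {x\<in>A. f x = b} = n"
  shows "map_pmf f (pmf_of_set A) = pmf_of_set B"
proof (rule pmf_eqI)
  fix b
  have B: "finite B" "B \<noteq> {}" using assms by auto
  have "pmf (map_pmf f (pmf_of_set A)) b = card {x\<in>A. f x = b} / card A"
    using assms(1,2) by (simp add: pmf_map measure_pmf_of_set Int_def vimage_def conj_commute)
  moreover have "card A = card B * n"
  proof -
    have "A = (\<Union>b\<in>B. {x\<in>A. f x = b})" using assms(3) by auto
    also have "card \<dots> = (\<Sum>b\<in>B. card {x\<in>A. f x = b})"
      using assms(1) B by (intro card_UN_disjoint) auto
    also have "\<dots> = card B * n" using card by simp
    finally show ?thesis .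
  qed
  moreover have "card A > 0" using assms by (simp add: card_gt_0_iff)
  moreover have "{x\<in>A. f x = b} = {}" if "b \<notin> B" using that assms(3) by auto
  ultimately show "pmf (map_pmf f (pmf_of_set A)) b = pmf (pmf_of_set B) b"
    using B card by (cases "b \<in> B") (auto simp: field_simps)
qed

text \<open>The numbering matches \<open>vel_index\<close>: the x-, y- and z-axis correspond to
  \<open>vel0\<close>, \<open>vel1\<close> and \<open>vel2\<close>.\<close>

definition axis_of :: "real \<times> real \<times> real \<Rightarrow> nat" where
  "axis_of d = (if d \<in> dir_x then 0 else if d \<in> dir_y then 1 else 2)"

lemma dirs_eq: "dirs = {(1, 0, 0), (-1, 0, 0), (0, 1, 0), (0, -1, 0), (0, 0, 1), (0, 0, -1)}"
  by (auto simp: dirs_def dir_x_def dir_y_def dir_z_def)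

lemma axis_simps [simp]:
  "axis_of (1, 0, 0) = 0" "axis_of (-1, 0, 0) = 0" "axis_of (0, 1, 0) = 1" "axis_of (0, -1, 0) = 1"
  "axis_of (0, 0, 1) = 2" "axis_of (0, 0, -1) = 2"
  by (simp_all add: axis_of_def dir_x_def dir_y_def)

lemma axis_iff:
  assumes "d \<in> dirs"
  shows "d \<in> dir_x \<longleftrightarrow> axis_of d = 0" "d \<in> dir_y \<longleftrightarrow> axis_of d = 1" "d \<in> dir_z \<longleftrightarrow> axis_of d = 2"
  using assms by (auto simp: dirs_def axis_of_def dir_x_def dir_y_def dir_z_def)

lemma axis_fibre:
  "{d\<in>dirs. axis_of d = 0} = dir_x" "{d\<in>dirs. axis_of d = 1} = dir_y" "{d\<in>dirs. axis_of d = 2} = dir_z"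
  by (auto simp: dirs_eq dir_x_def dir_y_def dir_z_def)

lemma card_axis_fibre: "i \<in> {0, 1, 2} \<Longrightarrow> card {d\<in>dirs. axis_of d = i} = 2"
  by (auto simp only: axis_fibre insert_iff empty_iff) (simp_all add: dir_x_def dir_y_def dir_z_def)

lemma axis_image: "axis_of ` dirs = {0, 1, 2}"
  by (auto simp: dirs_eq)

lemma finite_dirs: "finite dirs" "dirs \<noteq> {}"
  by (simp_all add: dirs_eq)

lemma axis_uniform: "map_pmf axis_of (pmf_of_set dirs) = pmf_of_set {0, 1, 2}"
  by (rule map_pmf_of_set_uniform[OF finite_dirs axis_image card_axis_fibre])

lemma orthogonal_iff_axis: "d \<in> dirs \<Longrightarrow> e \<in> dirs \<Longrightarrow> e \<bullet> d = 0 \<longleftrightarrow> axis_of e \<noteq> axis_of d"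
  by (auto simp: dirs_eq)

lemma orthogonal_dirs:
  assumes "d \<in> dirs"
  shows "{e\<in>dirs. e \<bullet> d = 0} = {e\<in>dirs. axis_of e \<noteq> axis_of d}"
  using orthogonal_iff_axis[OF assms] by auto

lemma orthogonal_dirs_nonempty: "{e\<in>dirs. axis_of e \<noteq> i} \<noteq> {}"
proof (cases "i = 0")
  case True
  then have "(0, 1, 0) \<in> {e\<in>dirs. axis_of e \<noteq> i}" by (simp add: dirs_eq)
  then show ?thesis by blast
next
  case False
  then have "(1, 0, 0) \<in> {e\<in>dirs. axis_of e \<noteq> i}" by (simp add: dirs_eq)
  then show ?thesis by blast
qed

text \<open>Each remaining axis carries exactly two of the allowed directions, so the fibres have
  equal size. This is the lumping condition for OSM.\<close>

lemma axis_orthogonal_uniform: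
  "map_pmf axis_of (pmf_of_set {e\<in>dirs. axis_of e \<noteq> i}) = pmf_of_set ({0, 1, 2} - {i})"
proof (rule map_pmf_of_set_uniform)
  show "card {e \<in> {e\<in>dirs. axis_of e \<noteq> i}. axis_of e = b} = 2" if "b \<in> {0, 1, 2} - {i}" for b
  proof -
    have "{e \<in> {e\<in>dirs. axis_of e \<noteq> i}. axis_of e = b} = {e\<in>dirs. axis_of e = b}" using that by auto
    then show ?thesis using card_axis_fibre[of b] that by simp
  qed
  show "axis_of ` {e\<in>dirs. axis_of e \<noteq> i} = {0, 1, 2} - {i}"
    unfolding axis_image[symmetric] by auto
qed (use finite_dirs orthogonal_dirs_nonempty in auto)

definition vel_index :: "real \<Rightarrow> real \<times> real \<Rightarrow> nat" where
  "vel_index c v = (if v = vel0 c then 0 else if v = vel1 c then 1 else 2)"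

lemma vel_index_simps [simp]:
  assumes "c > 0"
  shows "vel_index c (vel0 c) = 0" "vel_index c (vel1 c) = 1" "vel_index c (vel2 c) = 2"
  using assms by (auto simp: vel_index_def vel0_def vel1_def vel2_def)

lemma finite_vels: "finite (vels c)" "vels c \<noteq> {}"
  by (simp_all add: vels_def)

lemma vel_index_image: "c > 0 \<Longrightarrow> vel_index c ` vels c = {0, 1, 2}"
  by (auto simp: vels_def)

lemma inj_vel_index: "c > 0 \<Longrightarrow> inj_on (vel_index c) (vels c)"
  by (auto simp: vels_def inj_on_def)

lemma vel_index_uniform: "c > 0 \<Longrightarrow> map_pmf (vel_index c) (pmf_of_set (vels c)) = pmf_of_set {0, 1, 2}"
  by (subst map_pmf_of_set_inj) (simp_all add: inj_vel_index finite_vels vel_index_image)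

lemma vel_index_deviating:
  assumes "c > 0" "v \<in> vels c"
  shows "vels c - {v} \<noteq> {}"
    and "map_pmf (vel_index c) (pmf_of_set (vels c - {v})) = pmf_of_set ({0, 1, 2} - {vel_index c v})"
proof -
  have im: "vel_index c ` (vels c - {v}) = {0, 1, 2} - {vel_index c v}"
    using inj_on_image_set_diff[OF inj_vel_index[OF assms(1)], of "vels c" "{v}"]
      vel_index_image[OF assms(1)] assms(2) by simp
  moreover have "{0, 1, 2} - {vel_index c v} \<noteq> {}" by auto
  ultimately show ne: "vels c - {v} \<noteq> {}" by force
  show "map_pmf (vel_index c) (pmf_of_set (vels c - {v})) = pmf_of_set ({0, 1, 2} - {vel_index c v})"
    using ne im finite_vels inj_on_subset[OF inj_vel_index[OF assms(1)], of "vels c - {v}"]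
    by (subst map_pmf_of_set_inj) auto
qed

section \<open>Occupation times and planar positions as path integrals of labels\<close>

lemma switching_process_lumped:
  assumes "switching_process M lam S ch D" "finite S" "S \<noteq> {}"
    and "\<And>d. d \<in> S \<Longrightarrow> ch d \<subseteq> S \<and> ch d \<noteq> {}"
    and "map_pmf f (pmf_of_set S) = ini"
    and "\<And>d. d \<in> S \<Longrightarrow> map_pmf f (pmf_of_set (ch d)) = tr (f d)"
  obtains E where "lumped_switching M lam S ch D f ini tr E"
proof -
  from assms(1) obtain E where M: "prob_space M" and E: "poisson_events M lam E"
    "\<forall>t\<in>admissible_times lam. D t \<in> measurable M (count_space S)"
    "\<forall>w\<in>space M. \<forall>a\<in>admissible_times lam. \<forall>b\<ge>a. E w \<inter> {a<..b} = {} \<longrightarrow> D b w = D a w"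
    "\<forall>s\<in>admissible_times lam. \<forall>n. \<forall>d. \<forall>A\<in>events_after M E s.
        (\<forall>w\<in>A. \<exists>b. n \<le> num_events E s b w) \<longrightarrow>
        measure M (A \<inter> {w\<in>space M. \<forall>i\<le>n. D (event_time (E w) s i) w = d i})
          = measure M A * pmf (pmf_of_set S) (d 0) * (\<Prod>i<n. pmf (pmf_of_set (ch (d i))) (d (Suc i)))"
    unfolding switching_process_def by blast
  interpret prob_space M by (rule M)
  have "lumped_switching M lam S ch D f ini tr E"
  proof (unfold_locales; (fact assms(2-) E(1))?)
    show "D t \<in> measurable M (count_space S)" if "t \<in> admissible_times lam" for t
      using E(2) that by blast
    show "D b w = D a w"
      if "w \<in> space M" "a \<in> admissible_times lam" "a \<le> b" "E w \<inter> {a<..b} = {}" for w a b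
      using E(3) that by blast
    show "measure M (A \<inter> {w\<in>space M. \<forall>i\<le>n. D (event_time (E w) s i) w = x i})
        = measure M A * pmf (pmf_of_set S) (x 0) * (\<Prod>i<n. pmf (pmf_of_set (ch (x i))) (x (Suc i)))"
      if "s \<in> admissible_times lam" "A \<in> events_after M E s"
        "\<And>w. w \<in> A \<Longrightarrow> \<exists>b. n \<le> num_events E s b w" for s A n x
      by (rule E(4)[rule_format, OF that])
  qed
  then show ?thesis by (rule that)
qed

lemma (in lumped_switching) occupation_time_eq:
  assumes w: "w \<in> space M" and A: "\<And>d. d \<in> S \<Longrightarrow> d \<in> A \<longleftrightarrow> f d \<in> B"
  shows "occupation_time A D t w = (LINT u:{0<..t}|lborel. indicator B (f (D u w)))"
proof -
  define Z where "Z = {u\<in>{0<..t}. D u w \<in> A}"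
  have ind: "indicator {0<..t} u * indicator B (f (D u w)) = (indicator Z u :: real)" for u
    using A[OF D_in_S[OF w, of u]] by (auto simp: Z_def indicator_def)
  \<comment> \<open>Integrability of the indicator is used to read off that the random time set
    \<open>Z\<close> is Borel.\<close>
  have "integrable lborel (indicator Z :: real \<Rightarrow> real)"
    using path_integral(1)[OF w, of t "indicator B :: _ \<Rightarrow> real"] by (simp add: set_integrable_def ind)
  then have Z: "Z \<in> sets lborel"
    using borel_measurable_integrable borel_measurable_indicator_iff[of Z lborel] by auto
  let ?Y = "{u\<in>{0..t}. D u w \<in> A}"
  \<comment> \<open>\<open>D 0 w\<close> is unconstrained, so 0 may or may not belong to the time
    set; either way its measure is the same.\<close>
  have "?Y = Z \<or> ?Y = Z \<union> {0}"
    by (auto simp: Z_def less_le)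
  then have "measure lborel ?Y = measure lborel Z"
    using measure_Un_null_set[OF Z finite_imp_null_set_lborel, of "{0}"] by auto
  then show ?thesis
    using Z by (simp add: occupation_time_def set_lebesgue_integral_def ind[abs_def] ind)
qed

text \<open>Its path integral is the pair of times spent with labels 0 and 1; the third time is
  determined by these and \<open>t\<close>.\<close>

definition label_coords :: "nat \<Rightarrow> real \<times> real" where
  "label_coords i = (indicator {0} i, indicator {1} i)"

lemma set_integral_Pair_components:
  fixes F :: "'z \<Rightarrow> 'b::euclidean_space \<times> 'c::euclidean_space"
  assumes "set_integrable M A F"
  shows "fst (LINT x:A|M. F x) = (LINT x:A|M. fst (F x))"
    and "snd (LINT x:A|M. F x) = (LINT x:A|M. snd (F x))"
  using assms unfolding set_integrable_def set_lebesgue_integral_def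
  by (auto simp flip: integral_bounded_linear[OF bounded_linear_fst]
      integral_bounded_linear[OF bounded_linear_snd])

text \<open>At every positive time exactly one of the three label indicators is 1. Hence the side
  condition in \<open>occupation_density\<close> holds for every path and removes no mass.\<close>

lemma occupation_times_eq:
  assumes D: "lumped_switching M lam dirs ch D axis_of ini tr E" and w: "w \<in> space M" and t: "0 < t"
  shows "(occupation_time dir_x D t w, occupation_time dir_y D t w)
      = (LINT u:{0<..t}|lborel. label_coords (axis_of (D u w)))"
    and "occupation_time dir_x D t w + occupation_time dir_y D t w
      + occupation_time dir_z D t w = t"
proof -
  interpret lumped_switching M lam dirs ch D axis_of ini tr E by fact
  have x: "occupation_time dir_x D t w = (LINT u:{0<..t}|lborel. indicator {0} (axis_of (D u w)))"
    and y: "occupation_time dir_y D t w = (LINT u:{0<..t}|lborel. indicator {1} (axis_of (D u w)))"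
    and z: "occupation_time dir_z D t w = (LINT u:{0<..t}|lborel. indicator {2} (axis_of (D u w)))"
    by (rule occupation_time_eq[OF w]; simp add: axis_iff)+
  note int = path_integral(1)[OF w]
  show "(occupation_time dir_x D t w, occupation_time dir_y D t w)
      = (LINT u:{0<..t}|lborel. label_coords (axis_of (D u w)))"
    by (rule prod_eqI; simp only: set_integral_Pair_components[OF int] fst_conv snd_conv;
        simp only: x y label_coords_def fst_conv snd_conv)
  have "occupation_time dir_x D t w + occupation_time dir_y D t w + occupation_time dir_z D t w
      = (LINT u:{0<..t}|lborel. indicator {0} (axis_of (D u w)) + indicator {1} (axis_of (D u w))
          + indicator {2} (axis_of (D u w)))"
    unfolding x y z by (simp only: set_integral_add int)
  also have "\<dots> = (LINT u:{0<..t}|lborel. 1)"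
  proof (intro set_lebesgue_integral_cong allI impI)
    fix u assume "u \<in> {0<..t}"
    then have "axis_of (D u w) \<in> axis_of ` dirs"
      using D_in_S[OF w, of u] by (intro imageI) simp
    then have "axis_of (D u w) \<in> {0, 1, 2}" by (simp only: axis_image)
    then show "indicator {0} (axis_of (D u w)) + indicator {1} (axis_of (D u w))
        + indicator {2} (axis_of (D u w)) = (1 :: real)"
      by (elim insertE emptyE) simp_all
  qed simp
  also have "\<dots> = t"
    using t by (simp add: set_lebesgue_integral_def)
  finally show "occupation_time dir_x D t w + occupation_time dir_y D t w
      + occupation_time dir_z D t w = t" .
qed

lemma planar_integral_eq:
  assumes V: "lumped_switching M lam (vels c) ch V (vel_index c) ini tr E"
    and w: "w \<in> space M" and c: "0 < c" and t: "0 < t"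
  shows "integral {0..t} (\<lambda>u. V u w)
      = plane_position c t (LINT u:{0<..t}|lborel. label_coords (vel_index c (V u w)))"
proof -
  interpret lumped_switching M lam "vels c" ch V "vel_index c" ini tr E by fact
  let ?F = "\<lambda>u. label_coords (vel_index c (V u w))"
  let ?T = "LINT u:{0<..t}|lborel. ?F u"
  \<comment> \<open>Each velocity is affine in the label coordinates: \<open>k\<close> is
    \<open>vel2 c\<close>, and \<open>L\<close> sends the unit vectors to
    \<open>vel0 c - vel2 c\<close> and \<open>vel1 c - vel2 c\<close>.\<close>
  define L :: "real \<times> real \<Rightarrow> real \<times> real"
    where "L x = (3 * c / 2 * fst x, sqrt 3 * c / 2 * (fst x + 2 * snd x))" for x
  define k :: "real \<times> real" where "k = (- c / 2, - (sqrt 3 * c / 2))"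
  have L: "bounded_linear L"
    unfolding L_def
    by (intro bounded_linear_Pair bounded_linear_const_mult bounded_linear_add
        bounded_linear_fst bounded_linear_snd)
  \<comment> \<open>The motion is defined by a gauge integral over \<open>{0..t}\<close>. The
    Lebesgue integral is turned into one, and the endpoint 0 is added as a null set.\<close>
  have "(?F has_integral ?T) {0<..t}"
    using set_borel_integral_eq_integral[OF path_integral(1)[OF w, of t label_coords]]
    by (simp add: has_integral_integral)
  then have "(?F has_integral ?T) {0..t}"
    by (subst has_integral_spike_set_eq[of "{0..t}" "{0<..t}"])
       (auto intro: negligible_subset[OF negligible_sing[of 0]])
  then have "((\<lambda>u. L (?F u)) has_integral L ?T) {0..t}"
    using has_integral_linear[OF _ L] by (simp add: o_def)
  moreover have "((\<lambda>u. k) has_integral t *\<^sub>R k) {0..t}"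
    using has_integral_const_real[of k 0 t] t by simp
  ultimately have "((\<lambda>u. L (?F u) + k) has_integral L ?T + t *\<^sub>R k) {0..t}"
    by (rule has_integral_add)
  moreover have "V u w = L (?F u) + k" if "u \<in> {0..t} - {0}" for u
  proof -
    have "V u w \<in> vels c" using D_in_S[OF w, of u] that by simp
    then consider "V u w = vel0 c" | "V u w = vel1 c" | "V u w = vel2 c"
      by (auto simp: vels_def)
    then show ?thesis
    proof cases
      case 1
      then have "?F u = (1, 0)" using c by (simp add: label_coords_def)
      then show ?thesis by (simp only: 1) (simp add: L_def k_def vel0_def)
    next
      case 2
      then have "?F u = (0, 1)" using c by (simp add: label_coords_def)
      then show ?thesis by (simp only: 2) (simp add: L_def k_def vel1_def)
    next
      case 3
      then have "?F u = (0, 0)" using c by (simp add: label_coords_def)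
      then show ?thesis by (simp only: 3) (simp add: L_def k_def vel2_def)
    qed
  qed
  ultimately have "((\<lambda>u. V u w) has_integral L ?T + t *\<^sub>R k) {0..t}"
    by (rule has_integral_spike[OF negligible_sing[of 0], rotated])
  moreover have "L ?T + t *\<^sub>R k = plane_position c t ?T"
    by (simp add: L_def k_def plane_position_def field_simps)
  ultimately show ?thesis by (metis integral_unique)
qed

lemma density_on_cong:
  assumes "density_on \<nu> A f" and "\<And>B. B \<in> sets borel \<Longrightarrow> \<nu> B = \<nu>' B"
  shows "density_on \<nu>' A f"
  using assms unfolding density_on_def by simp

lemma occupation_density_AE:
  assumes D: "lumped_switching M lam dirs ch D axis_of ini tr E"
    and V: "lumped_switching M' lam (vels c) ch' V (vel_index c) ini tr E'"
    and W: "\<forall>t\<ge>0. \<forall>w\<in>space M'. W t w = integral {0..t} (\<lambda>u. V u w)"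
    and p: "occupation_density M D p" and q: "transition_density M' c W q"
    and c: "0 < c" and t: "0 < t"
  shows "AE x in lborel. x \<in> open_simplex t \<longrightarrow>
    (\<lambda>(s, r). p t s r) x = 3 * sqrt 3 * c\<^sup>2 / 2 * (\<lambda>(u, v). q t u v) (plane_position c t x)"
proof -
  interpret D: lumped_switching M lam dirs ch D axis_of ini tr E by fact
  interpret V: lumped_switching M' lam "vels c" ch' V "vel_index c" ini tr E' by fact
  let ?T = "\<lambda>w. LINT u:{0<..t}|lborel. label_coords (axis_of (D u w))"
  let ?T' = "\<lambda>w. LINT u:{0<..t}|lborel. label_coords (vel_index c (V u w))"
  \<comment> \<open>The common law of the two pairs of times. The density \<open>p\<close> belongs
    to \<open>P\<close> itself, and \<open>q\<close> to its image under
    \<open>plane_position c t\<close>.\<close>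
  define P where "P = distr M borel ?T"
  have P': "P = distr M' borel ?T'"
    unfolding P_def by (rule distr_path_integral_eq[OF D V])
  show ?thesis
  proof (rule density_transfer[OF c])
    show "sets P = sets borel" by (simp add: P_def)
    have "emeasure M {w\<in>space M. (occupation_time dir_x D t w, occupation_time dir_y D t w) \<in> B \<and>
        occupation_time dir_x D t w + occupation_time dir_y D t w + occupation_time dir_z D t w = t}
      = emeasure P B" if "B \<in> sets borel" for B
    proof -
      have "{w\<in>space M. (occupation_time dir_x D t w, occupation_time dir_y D t w) \<in> B \<and>
          occupation_time dir_x D t w + occupation_time dir_y D t w + occupation_time dir_z D t w = t}
        = ?T -` B \<inter> space M"
        using occupation_times_eq[OF D _ t] by auto
      then show ?thesis
        using that by (simp add: P_def emeasure_distr D.measurable_path_integral)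
    qed
    then show "density_on (emeasure P) (open_simplex t) (\<lambda>(s, r). p t s r)"
      by (rule density_on_cong[OF p[unfolded occupation_density_def, rule_format, OF t]])
    have "emeasure M' {w\<in>space M'. W t w \<in> B} = emeasure P (plane_position c t -` B)"
      if B: "B \<in> sets borel" for B
    proof -
      have "{w\<in>space M'. W t w \<in> B} = ?T' -` (plane_position c t -` B) \<inter> space M'"
        using W planar_integral_eq[OF V _ c t] t by auto
      moreover have "plane_position c t -` B \<in> sets borel"
        using measurable_sets[OF measurable_plane_position B, of c t] by simp
      ultimately show ?thesis
        by (simp add: P' emeasure_distr V.measurable_path_integral)
    qed
    then show "ac_density_on (\<lambda>B. emeasure P (plane_position c t -` B)) (open_triangle c t)
        (\<lambda>(u, v). q t u v)"
      using q[unfolded transition_density_def, rule_format, OF t] unfolding ac_density_on_def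
      by (blast intro: density_on_cong)
  qed
qed

theorem theorem4p2:
  fixes M :: "'a measure" and M' :: "'b measure"
    and c :: real and lam :: "real \<Rightarrow> real"
    and D R :: "real \<Rightarrow> 'a \<Rightarrow> real \<times> real \<times> real"
    and V W :: "real \<Rightarrow> 'b \<Rightarrow> real \<times> real"
    and p q :: "real \<Rightarrow> real \<Rightarrow> real \<Rightarrow> real"
  assumes "c > 0"
    and "\<forall>t>0. lam t > 0"
    and "lam C1_differentiable_on {0<..}" and "deriv lam C1_differentiable_on {0<..}"
    and "(orthogonal_standard_motion M c lam D R \<and> planar_deviating_motion M' c lam V W) \<or>
         (orthogonal_uniform_motion M c lam D R \<and> planar_uniform_motion M' c lam V W)"
    and "occupation_density M D p"
    and "transition_density M' c W q"
  shows "\<forall>t>0.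
     (AE (s, r) in lborel. 0 < s \<and> 0 < r \<and> s + r < t \<longrightarrow>
        p t s r = 3 * sqrt 3 * c\<^sup>2 / 2 *
          q t (c / 2 * (3 * s - t)) (sqrt 3 * c / 2 * (s + 2 * r - t))) \<and>
     (continuous_on (open_simplex t) (\<lambda>(s, r). p t s r) \<and>
      continuous_on (open_triangle c t) (\<lambda>(u, v). q t u v) \<longrightarrow>
      (\<forall>s r. 0 < s \<and> 0 < r \<and> s + r < t \<longrightarrow>
        p t s r = 3 * sqrt 3 * c\<^sup>2 / 2 *
          q t (c / 2 * (3 * s - t)) (sqrt 3 * c / 2 * (s + 2 * r - t))))"
proof (intro allI impI)
  fix t :: real assume t: "0 < t"
  have c: "c > 0" by fact
  have W: "\<forall>t\<ge>0. \<forall>w\<in>space M'. W t w = integral {0..t} (\<lambda>u. V u w)"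
    using assms(5) unfolding planar_deviating_motion_def planar_uniform_motion_def by blast
  let ?f = "\<lambda>(s, r). p t s r"
  let ?g = "\<lambda>x. 3 * sqrt 3 * c\<^sup>2 / 2 * (\<lambda>(u, v). q t u v) (plane_position c t x)"
  have AE: "AE x in lborel. x \<in> open_simplex t \<longrightarrow> ?f x = ?g x"
    using assms(5)
  proof
    assume *: "orthogonal_standard_motion M c lam D R \<and> planar_deviating_motion M' c lam V W"
    \<comment> \<open>Orthogonal directions are those on another axis, two per axis, so the OSM axis
      follows the same kernel as the index of the deviating velocity.\<close>
    let ?tr = "\<lambda>i. pmf_of_set ({0, 1, 2} - {i})"
    have "switching_process M lam dirs (\<lambda>d. {e\<in>dirs. e \<bullet> d = 0}) D"
      using * by (simp add: orthogonal_standard_motion_def)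
    then obtain E where E: "lumped_switching M lam dirs (\<lambda>d. {e\<in>dirs. e \<bullet> d = 0}) D axis_of
        (pmf_of_set {0, 1, 2}) ?tr E"
      by (rule switching_process_lumped[where f = axis_of and tr = ?tr, OF _ finite_dirs _ axis_uniform])
         (use orthogonal_dirs_nonempty in \<open>auto simp: orthogonal_dirs axis_orthogonal_uniform\<close>)
    have "switching_process M' lam (vels c) (\<lambda>v. vels c - {v}) V"
      using * by (simp add: planar_deviating_motion_def)
    then obtain E' where E': "lumped_switching M' lam (vels c) (\<lambda>v. vels c - {v}) V (vel_index c)
        (pmf_of_set {0, 1, 2}) ?tr E'"
      by (rule switching_process_lumped[where f = "vel_index c" and tr = ?tr,
            OF _ finite_vels _ vel_index_uniform[OF c]])
         (use vel_index_deviating[OF c] in auto)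
    show ?thesis by (rule occupation_density_AE[OF E E' W assms(6,7) c t])
  next
    assume *: "orthogonal_uniform_motion M c lam D R \<and> planar_uniform_motion M' c lam V W"
    \<comment> \<open>A uniform choice among the six directions is a uniform choice of axis,
      whatever the current one is.\<close>
    let ?tr = "\<lambda>i :: nat. pmf_of_set {0, 1, 2 :: nat}"
    have "switching_process M lam dirs (\<lambda>d. dirs) D"
      using * by (simp add: orthogonal_uniform_motion_def)
    then obtain E where E: "lumped_switching M lam dirs (\<lambda>d. dirs) D axis_of
        (pmf_of_set {0, 1, 2}) ?tr E"
      by (rule switching_process_lumped[where f = axis_of and tr = ?tr, OF _ finite_dirs _ axis_uniform])
         (use finite_dirs axis_uniform in auto)
    have "switching_process M' lam (vels c) (\<lambda>v. vels c) V"
      using * by (simp add: planar_uniform_motion_def)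
    then obtain E' where E': "lumped_switching M' lam (vels c) (\<lambda>v. vels c) V (vel_index c)
        (pmf_of_set {0, 1, 2}) ?tr E'"
      by (rule switching_process_lumped[where f = "vel_index c" and tr = ?tr,
            OF _ finite_vels _ vel_index_uniform[OF c]])
         (use finite_vels vel_index_uniform[OF c] in auto)
    show ?thesis by (rule occupation_density_AE[OF E E' W assms(6,7) c t])
  qed
  show "(AE (s, r) in lborel. 0 < s \<and> 0 < r \<and> s + r < t \<longrightarrow>
        p t s r = 3 * sqrt 3 * c\<^sup>2 / 2 *
          q t (c / 2 * (3 * s - t)) (sqrt 3 * c / 2 * (s + 2 * r - t))) \<and>
     (continuous_on (open_simplex t) (\<lambda>(s, r). p t s r) \<and>
      continuous_on (open_triangle c t) (\<lambda>(u, v). q t u v) \<longrightarrow>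
      (\<forall>s r. 0 < s \<and> 0 < r \<and> s + r < t \<longrightarrow>
        p t s r = 3 * sqrt 3 * c\<^sup>2 / 2 *
          q t (c / 2 * (3 * s - t)) (sqrt 3 * c / 2 * (s + 2 * r - t))))"
  proof (intro conjI impI allI)
    show "AE (s, r) in lborel. 0 < s \<and> 0 < r \<and> s + r < t \<longrightarrow>
        p t s r = 3 * sqrt 3 * c\<^sup>2 / 2 *
          q t (c / 2 * (3 * s - t)) (sqrt 3 * c / 2 * (s + 2 * r - t))"
      using AE by eventually_elim (auto simp: open_simplex_def plane_position_def)
    fix s r
    assume cont: "continuous_on (open_simplex t) ?f \<and>
        continuous_on (open_triangle c t) (\<lambda>(u, v). q t u v)"
      and sr: "0 < s \<and> 0 < r \<and> s + r < t"
    \<comment> \<open>Continuity of \<open>q\<close> is available on the open triangle, into which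
      \<open>plane_position c t\<close> maps the simplex.\<close>
    have "continuous_on (open_simplex t) ?g"
      using continuous_on_compose2[OF conjunct2[OF cont] continuous_plane_position
          plane_position_simplex_subset[OF c]]
      by (intro continuous_on_mult continuous_on_const)
    then have "?f (s, r) = ?g (s, r)"
      using cont sr AE
      by (intro continuous_on_AE_eq[OF open_open_simplex[of t]]) (auto simp: open_simplex_def)
    then show "p t s r = 3 * sqrt 3 * c\<^sup>2 / 2 *
          q t (c / 2 * (3 * s - t)) (sqrt 3 * c / 2 * (s + 2 * r - t))"
      by (simp add: plane_position_def)
  qed
qed

end
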